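(* Assume $\diamondsuit$. Then there is a $0$-dimensional, Hausdorff, hereditarily Lindelöf topological space which is not strongly $D$.
   Context: $\diamondsuit$ is Jensen's diamond principle on $\omega_1$: there is a sequence $\langle A_\alpha:\alpha<\omega_1\rangle$ with $A_\alpha\subseteq\alpha$ such that for every $A\subseteq\omega_1$ the set $\{\alpha<\omega_1: A\cap\alpha=A_\alpha\}$ is stationary in $\omega_1$. A neighbourhood assignment on a topological space $X$ is a family $\{U_x:x\in X\}$ of open subsets of $X$ with $x\in U_x$ for every $x\in X$. A space $X$ is strongly $D$ if for every neighbourhood assignment $\{U_x:x\in X\}$ there is a set $D\subseteq X$ such that $\{U_x:x\in D\}$ covers $X$ and $D$ is locally finite in the topology on $X$ generated by $\{U_x:x\in X\}$, i.e., for each $z\in X$ there is a finite $F\subseteq X$ such that $z\in\bigcap\{U_x:x\in F\}$ and $D\cap\bigcap\{U_x:x\in F\}$ is finite. A space is $0$-dimensional if it has a base of clopen sets, and hereditarily Lindelöf if each of its subspaces is Lindelöf. *)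

theory Defs
  imports "HOL-Analysis.Analysis"
begin

section \<open>The first uncountable ordinal and the diamond principle\<close>

text \<open>
  The ordinal \<open>\<omega>\<^sub>1\<close> is represented by the successor cardinal of \<open>\<omega>\<close>, a (reflexive) well-order.
  Its elements, the countable ordinals, are the members of \<open>Field omega1\<close> (which need not be all
  of the carrier type), and an ordinal \<open>\<alpha>\<close>, regarded as the set of its predecessors, is
  \<open>underS omega1 \<alpha>\<close>.
\<close>

definition omega1 :: "nat set rel" where
  "omega1 = cardSuc natLeq"

lemma Well_order_omega1: "Well_order omega1"
  unfolding omega1_def by (rule cardSuc_Well_order[OF natLeq_Card_order])

lemma countable_iff_card_of_nat:
  "countable A \<longleftrightarrow> (card_of A, card_of (UNIV :: nat set)) \<in> ordLeq"
  unfolding countable_def card_of_ordLeq[symmetric] by simp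

lemma uncountable_omega1: "uncountable (Field omega1)"
proof
  assume "countable (Field omega1)"
  then have "(card_of (Field omega1), card_of (UNIV :: nat set)) \<in> ordLeq"
    using countable_iff_card_of_nat by blast
  moreover have "(card_of (Field omega1), omega1) \<in> ordIso"
    unfolding omega1_def by (rule card_of_Field_ordIso[OF cardSuc_Card_order[OF natLeq_Card_order]])
  moreover have "(natLeq, omega1) \<in> ordLess"
    unfolding omega1_def by (rule cardSuc_greater[OF natLeq_Card_order])
  moreover have "(card_of (UNIV :: nat set), natLeq) \<in> ordIso"
    by (rule card_of_nat)
  ultimately show False
    by (meson not_ordLess_ordLeq ordIso_ordLeq_trans ordIso_symmetric ordLeq_ordIso_trans)
qed

lemma countable_underS_omega1:
  assumes "\<alpha> \<in> Field omega1"
  shows "countable (underS omega1 \<alpha>)"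
proof -
  have "(card_of (underS omega1 \<alpha>), omega1) \<in> ordLess"
    using assms card_of_underS[OF cardSuc_Card_order[OF natLeq_Card_order]]
    unfolding omega1_def by blast
  then have "(card_of (underS omega1 \<alpha>), natLeq) \<in> ordLeq"
    unfolding omega1_def
    using cardSuc_ordLeq_ordLess[OF natLeq_Card_order card_of_Card_order] by blast
  then show ?thesis
    using card_of_nat countable_iff_card_of_nat ordIso_symmetric ordLeq_ordIso_trans by blast
qed

definition unbounded_omega1 :: "nat set set \<Rightarrow> bool" where
  "unbounded_omega1 C \<longleftrightarrow> (\<forall>\<alpha>\<in>Field omega1. \<exists>\<beta>\<in>C. \<alpha> \<in> underS omega1 \<beta>)"

text \<open>
  A nonzero \<open>\<delta>\<close> such that every \<open>\<alpha> < \<delta>\<close> lies strictly below some \<open>\<beta> \<in> C \<inter> \<delta>\<close> is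
  necessarily a limit ordinal, namely a limit point of \<open>C\<close>.
\<close>

definition closed_omega1 :: "nat set set \<Rightarrow> bool" where
  "closed_omega1 C \<longleftrightarrow>
     (\<forall>\<delta>\<in>Field omega1.
        underS omega1 \<delta> \<noteq> {} \<and>
        (\<forall>\<alpha>\<in>underS omega1 \<delta>. \<exists>\<beta>\<in>C \<inter> underS omega1 \<delta>. \<alpha> \<in> underS omega1 \<beta>)
        \<longrightarrow> \<delta> \<in> C)"

definition club_omega1 :: "nat set set \<Rightarrow> bool" where
  "club_omega1 C \<longleftrightarrow> C \<subseteq> Field omega1 \<and> unbounded_omega1 C \<and> closed_omega1 C"

definition stationary_omega1 :: "nat set set \<Rightarrow> bool" where
  "stationary_omega1 S \<longleftrightarrow> S \<subseteq> Field omega1 \<and> (\<forall>C. club_omega1 C \<longrightarrow> S \<inter> C \<noteq> {})"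

definition diamond :: bool where
  "diamond \<longleftrightarrow>
     (\<exists>A :: nat set \<Rightarrow> nat set set.
        (\<forall>\<alpha>\<in>Field omega1. A \<alpha> \<subseteq> underS omega1 \<alpha>) \<and>
        (\<forall>B\<subseteq>Field omega1. stationary_omega1 {\<alpha>\<in>Field omega1. B \<inter> underS omega1 \<alpha> = A \<alpha>}))"


section \<open>Topological notions\<close>

definition zero_dimensional_space :: "'a topology \<Rightarrow> bool" where
  "zero_dimensional_space X \<longleftrightarrow>
     (\<exists>\<B>. (\<forall>U\<in>\<B>. openin X U \<and> closedin X U) \<and> openin X = arbitrary union_of (\<lambda>U. U \<in> \<B>))"

definition hereditarily_Lindelof_space :: "'a topology \<Rightarrow> bool" where
  "hereditarily_Lindelof_space X \<longleftrightarrow> (\<forall>S\<subseteq>topspace X. Lindelof_space (subtopology X S))"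

definition neighbourhood_assignment :: "'a topology \<Rightarrow> ('a \<Rightarrow> 'a set) \<Rightarrow> bool" where
  "neighbourhood_assignment X U \<longleftrightarrow> (\<forall>x\<in>topspace X. openin X (U x) \<and> x \<in> U x)"

text \<open>
  Local finiteness of \<open>D\<close> in the topology on the underlying set of \<open>X\<close> generated by the sets
  \<open>U x\<close>. For \<open>F = {}\<close> the intersection below is \<open>UNIV\<close> rather than the whole space; this is
  harmless because \<open>D\<close> is only ever a subset of the space.
\<close>

definition locally_finite_for :: "'a topology \<Rightarrow> ('a \<Rightarrow> 'a set) \<Rightarrow> 'a set \<Rightarrow> bool" where
  "locally_finite_for X U D \<longleftrightarrow>
     (\<forall>z\<in>topspace X. \<exists>F\<subseteq>topspace X.
        finite F \<and> z \<in> (\<Inter>x\<in>F. U x) \<and> finite (D \<inter> (\<Inter>x\<in>F. U x)))"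

lemma locally_finite_for_iff_generated:
  assumes U: "neighbourhood_assignment X U"
  shows "locally_finite_for X U D \<longleftrightarrow>
    (\<forall>z\<in>topspace X. \<exists>V. openin (topology_generated_by (U ` topspace X)) V \<and> z \<in> V \<and> finite (D \<inter> V))"
    (is "?L \<longleftrightarrow> ?R")
proof
  assume L: ?L
  show ?R
  proof
    fix z assume z: "z \<in> topspace X"
    with L obtain F where F: "F \<subseteq> topspace X" "finite F" "z \<in> (\<Inter>x\<in>F. U x)"
      "finite (D \<inter> (\<Inter>x\<in>F. U x))"
      unfolding locally_finite_for_def by blast
    let ?V = "\<Inter>x\<in>insert z F. U x"
    have "generate_topology_on (U ` topspace X) ?V"
      by (rule generate_topology_on_Inter) (use F z in \<open>auto intro: generate_topology_on.Basis\<close>)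
    moreover have "z \<in> ?V"
      using F z U by (auto simp: neighbourhood_assignment_def)
    moreover have "finite (D \<inter> ?V)"
      by (rule finite_subset[OF _ F(4)]) auto
    ultimately show "\<exists>V. openin (topology_generated_by (U ` topspace X)) V \<and> z \<in> V \<and> finite (D \<inter> V)"
      by (metis openin_topology_generated_by_iff)
  qed
next
  assume R: ?R
  have *: "\<exists>F\<subseteq>topspace X. finite F \<and> z \<in> (\<Inter>x\<in>F. U x) \<and> (\<Inter>x\<in>F. U x) \<subseteq> V"
    if "generate_topology_on (U ` topspace X) V" "z \<in> V" for z V
    using that
  proof induction
    case Empty
    then show ?case by simp
  next
    case (Int a b)
    then obtain F G where "F \<subseteq> topspace X" "finite F" "z \<in> (\<Inter>x\<in>F. U x)" "(\<Inter>x\<in>F. U x) \<subseteq> a"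
      "G \<subseteq> topspace X" "finite G" "z \<in> (\<Inter>x\<in>G. U x)" "(\<Inter>x\<in>G. U x) \<subseteq> b"
      by auto
    then show ?case by (intro exI[of _ "F \<union> G"]) auto
  next
    case (UN K)
    then show ?case by (meson Union_iff Union_upper order_trans)
  next
    case (Basis s)
    then obtain y where "y \<in> topspace X" "s = U y" by blast
    with Basis show ?case by (intro exI[of _ "{y}"]) auto
  qed
  show ?L
    unfolding locally_finite_for_def
  proof
    fix z assume "z \<in> topspace X"
    with R obtain V where V: "generate_topology_on (U ` topspace X) V" "z \<in> V" "finite (D \<inter> V)"
      by (metis openin_topology_generated_by_iff)
    from *[OF V(1,2)] obtain F where F: "F \<subseteq> topspace X" "finite F" "z \<in> (\<Inter>x\<in>F. U x)"
      "(\<Inter>x\<in>F. U x) \<subseteq> V" by blast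
    have "finite (D \<inter> (\<Inter>x\<in>F. U x))"
      by (rule finite_subset[OF _ V(3)]) (use F(4) in blast)
    with F show "\<exists>F\<subseteq>topspace X. finite F \<and> z \<in> (\<Inter>x\<in>F. U x) \<and> finite (D \<inter> (\<Inter>x\<in>F. U x))"
      by blast
  qed
qed

definition strongly_D_space :: "'a topology \<Rightarrow> bool" where
  "strongly_D_space X \<longleftrightarrow>
     (\<forall>U. neighbourhood_assignment X U \<longrightarrow>
        (\<exists>D\<subseteq>topspace X. topspace X \<subseteq> (\<Union>x\<in>D. U x) \<and> locally_finite_for X U D))"

end

theory Submission
  imports Defs
begin

text \<open>
  The points are the countable ordinals. For every \<open>y\<close> a set \<open>V y\<close> of smaller ordinals is chosen by
  recursion, and \<open>U x\<close> consists of all \<open>y \<le> x\<close> and all \<open>y > x\<close> with \<open>x \<in> V y\<close>. If a guess at \<open>c\<close> is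
  (an initial part of) an uncountable family of disjoint pairs of finite sets, then \<open>V c\<close> is chosen
  such that the family accumulates at \<open>c\<close>, and every later \<open>y\<close> is put into the basic set of some pair
  of the guess; by a Delta-system argument no uncountable set is then right separated.
  If instead the guess is a countable set \<open>D\<close> that is locally finite with respect to \<open>U\<close>, then
  \<open>V c\<close> is chosen disjoint from \<open>D\<close>, so that \<open>c\<close> is not covered by the \<open>U x\<close> with \<open>x \<in> D\<close>. The two
  kinds of demands are compatible: the pairs still to be used accumulate at earlier points, so a
  locally finite \<open>D\<close> misses the first components of infinitely many of them.
\<close>

section \<open>Uncountable families of finite sets\<close>

lemma countable_atMost_if_lessThan:
  fixes a :: "'a::linorder"
  assumes "countable {..<a}"
  shows "countable {..a}"
proof -
  have "{..a} = insert a {..<a}" by auto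
  then show ?thesis using assms by simp
qed

lemma uncountable_fibre:
  assumes "uncountable M" "countable (f ` M)"
  shows "\<exists>c. uncountable {x \<in> M. f x = c}"
proof -
  have "M = (\<Union>c\<in>f ` M. {x \<in> M. f x = c})" by blast
  then show ?thesis
    using assms countable_UN[of "f ` M" "\<lambda>c. {x \<in> M. f x = c}"] by metis
qed

text \<open>Zorn's lemma applied to the subfamilies with pairwise disjoint values. The last clause
  is maximality; contrapositively, for every \<open>x \<in> M - N\<close> the set \<open>E x\<close>
  meets some \<open>E y\<close> with \<open>y \<in> N\<close>.\<close>

lemma maximal_disjoint_subfamily:
  "\<exists>N\<subseteq>M. (\<forall>x\<in>N. \<forall>y\<in>N. x \<noteq> y \<longrightarrow> E x \<inter> E y = {}) \<and>
     (\<forall>x\<in>M. (\<forall>y\<in>N. E x \<inter> E y = {}) \<longrightarrow> x \<in> N)"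
proof -
  define A where "A = {N. N \<subseteq> M \<and> (\<forall>x\<in>N. \<forall>y\<in>N. x \<noteq> y \<longrightarrow> E x \<inter> E y = {})}"
  have "\<Union>C \<in> A" if C: "subset.chain A C" for C
  proof -
    have "\<exists>N\<in>C. x \<in> N \<and> y \<in> N" if "x \<in> \<Union>C" "y \<in> \<Union>C" for x y
      using C that unfolding subset.chain_def by blast
    moreover have sub: "N \<subseteq> M" and dis: "\<forall>x\<in>N. \<forall>y\<in>N. x \<noteq> y \<longrightarrow> E x \<inter> E y = {}"
      if "N \<in> C" for N
    proof -
      have "N \<in> A" using C that unfolding subset.chain_def by blast
      then show "N \<subseteq> M" "\<forall>x\<in>N. \<forall>y\<in>N. x \<noteq> y \<longrightarrow> E x \<inter> E y = {}" by (simp_all add: A_def)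
    qed
    ultimately have "E x \<inter> E y = {}" if "x \<in> \<Union>C" "y \<in> \<Union>C" "x \<noteq> y" for x y
      using that by metis
    moreover have "\<Union>C \<subseteq> M" using sub by (rule Union_least)
    ultimately show ?thesis unfolding A_def by (intro CollectI conjI ballI impI)
  qed
  from subset_Zorn'[of A, OF this] obtain N where N: "N \<in> A" "\<And>N'. \<lbrakk>N' \<in> A; N \<subseteq> N'\<rbrakk> \<Longrightarrow> N' = N"
    by blast
  have "x \<in> N" if x: "x \<in> M" "\<forall>y\<in>N. E x \<inter> E y = {}" for x
  proof -
    have "insert x N \<in> A" using N(1) x unfolding A_def by (auto simp: Int_commute)
    then show ?thesis using N(2) by blast
  qed
  moreover have "N \<subseteq> M" "\<forall>x\<in>N. \<forall>y\<in>N. x \<noteq> y \<longrightarrow> E x \<inter> E y = {}"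
    using N(1) by (simp_all add: A_def)
  ultimately show ?thesis by (intro exI[of _ N] conjI ballI impI) simp_all
qed

text \<open>Fix the size of \<open>E x\<close> and take \<open>R\<close> of maximal cardinality
  among the finite sets contained in uncountably many of these \<open>E x\<close>. A point outside
  \<open>R\<close> then lies in only countably many \<open>E x\<close> containing \<open>R\<close>,
  so a countable disjoint subfamily of the sets \<open>E x - R\<close> cannot be maximal.\<close>

lemma delta_system:
  assumes "uncountable M" "\<And>x. x \<in> M \<Longrightarrow> finite (E x)"
  shows "\<exists>R N. finite R \<and> N \<subseteq> M \<and> uncountable N \<and>
    (\<forall>x\<in>N. \<forall>y\<in>N. x \<noteq> y \<longrightarrow> (E x - R) \<inter> (E y - R) = {})"
proof -
  have "\<exists>n. uncountable {x \<in> M. card (E x) = n}"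
    using uncountable_fibre[OF assms(1) countableI_type[of "(\<lambda>x. card (E x)) ` M"]] .
  then obtain n where n: "uncountable {x \<in> M. card (E x) = n}" by blast
  define M1 where "M1 = {x \<in> M. card (E x) = n}"
  define \<R> where "\<R> = {R. finite R \<and> uncountable {x \<in> M1. R \<subseteq> E x}}"
  have "{} \<in> \<R>" using n by (simp add: \<R>_def M1_def)
  moreover have "card R \<le> n" if "R \<in> \<R>" for R
  proof -
    have "uncountable {x \<in> M1. R \<subseteq> E x}" using \<open>R \<in> \<R>\<close> by (simp add: \<R>_def)
    then have "{x \<in> M1. R \<subseteq> E x} \<noteq> {}" by (metis countable_empty)
    then obtain x where "x \<in> M1" "R \<subseteq> E x" by blast
    then have "card R \<le> card (E x)" using assms(2) by (intro card_mono) (auto simp: M1_def)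
    then show ?thesis using \<open>x \<in> M1\<close> by (simp add: M1_def)
  qed
  ultimately have "\<exists>R. R \<in> \<R> \<and> (\<forall>R'. R' \<in> \<R> \<longrightarrow> card R' \<le> card R)"
    by (intro ex_has_greatest_nat[of _ "{}" _ "Suc n"]) (simp_all add: less_Suc_eq_le)
  then obtain R where R: "R \<in> \<R>" "\<forall>R'. R' \<in> \<R> \<longrightarrow> card R' \<le> card R" by blast
  define M2 where "M2 = {x \<in> M1. R \<subseteq> E x}"
  have M2: "uncountable M2" "M2 \<subseteq> M" "finite R"
    using R(1) by (auto simp: M2_def \<R>_def M1_def)
  have ctbl: "countable {x \<in> M2. a \<in> E x}" if "a \<notin> R" for a
  proof (rule ccontr)
    assume "uncountable {x \<in> M2. a \<in> E x}"
    moreover have "{x \<in> M2. a \<in> E x} = {x \<in> M1. insert a R \<subseteq> E x}"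
      unfolding M2_def by auto
    ultimately have "insert a R \<in> \<R>" using M2(3) by (simp add: \<R>_def)
    then have "card (insert a R) \<le> card R" using R(2) by blast
    then show False using that M2(3) by simp
  qed
  obtain N where N: "N \<subseteq> M2" "\<forall>x\<in>N. \<forall>y\<in>N. x \<noteq> y \<longrightarrow> (E x - R) \<inter> (E y - R) = {}"
    "\<forall>x\<in>M2. (\<forall>y\<in>N. (E x - R) \<inter> (E y - R) = {}) \<longrightarrow> x \<in> N"
    using maximal_disjoint_subfamily[of M2 "\<lambda>x. E x - R"] by auto
  have "uncountable N"
  proof
    assume N_ctbl: "countable N"
    define Z where "Z = (\<Union>y\<in>N. \<Union>a\<in>E y - R. {x \<in> M2. a \<in> E x})"
    have "M2 \<subseteq> N \<union> Z"
    proof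
      fix x assume x: "x \<in> M2"
      show "x \<in> N \<union> Z"
      proof (rule ccontr)
        assume "x \<notin> N \<union> Z"
        then have "x \<notin> N" "x \<notin> Z" by simp_all
        with x N(3) have "\<not> (\<forall>y\<in>N. (E x - R) \<inter> (E y - R) = {})" by (meson bspec)
        then obtain y a where "y \<in> N" "a \<in> E x" "a \<in> E y - R" by blast
        with x have "x \<in> Z" unfolding Z_def by (intro UN_I CollectI conjI)
        with \<open>x \<notin> Z\<close> show False ..
      qed
    qed
    moreover have "countable Z"
      unfolding Z_def
    proof (rule countable_UN[OF N_ctbl], rule countable_UN)
      fix y assume "y \<in> N"
      then have "finite (E y)" using N(1) M2(2) assms(2) by blast
      then show "countable (E y - R)" by (simp add: countable_finite)
      show "countable {x \<in> M2. a \<in> E x}" if "a \<in> E y - R" for a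
        using that ctbl[of a] by simp
    qed
    ultimately show False
      using N_ctbl M2(1) countable_subset[of M2 "N \<union> Z"] by simp
  qed
  moreover have "N \<subseteq> M" using M2(2) N(1) by blast
  ultimately show ?thesis
    using M2(3) N(2) by (intro exI[of _ R] exI[of _ N] conjI)
qed


section \<open>Blocks\<close>

text \<open>
  A block \<open>(F, G)\<close> stands for the basic set of all \<open>y\<close> that lie in \<open>U x\<close> for \<open>x \<in> F\<close> and outside
  \<open>U x\<close> for \<open>x \<in> G\<close>. For \<open>y\<close> above the block this only depends on \<open>V = {x. x < y \<and> y \<in> U x}\<close>.
\<close>

definition satisfies :: "'a set \<Rightarrow> 'a set \<times> 'a set \<Rightarrow> bool" where
  "satisfies V p \<longleftrightarrow> fst p \<subseteq> V \<and> snd p \<inter> V = {}"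

definition supp :: "'a set \<times> 'a set \<Rightarrow> 'a set" where
  "supp p = fst p \<union> snd p"

text \<open>Nonempty supports make disjoint blocks distinct. They also keep \<open>({}, {})\<close>
  out of every such family, which frees its code to mark the other kind of guess.\<close>

definition disjoint_blocks :: "('a set \<times> 'a set) set \<Rightarrow> bool" where
  "disjoint_blocks S \<longleftrightarrow>
     (\<forall>p\<in>S. finite (supp p) \<and> fst p \<inter> snd p = {} \<and> supp p \<noteq> {}) \<and>
     (\<forall>p\<in>S. \<forall>q\<in>S. p \<noteq> q \<longrightarrow> supp p \<inter> supp q = {})"

lemma disjoint_blocks_subset: "\<lbrakk>disjoint_blocks S; T \<subseteq> S\<rbrakk> \<Longrightarrow> disjoint_blocks T"
  unfolding disjoint_blocks_def by (meson subsetD)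

text \<open>By disjointness each point of \<open>T\<close> belongs to at most one block.\<close>

lemma finite_blocks_meeting:
  assumes "disjoint_blocks S" "finite T"
  shows "finite {p \<in> S. supp p \<inter> T \<noteq> {}}"
proof -
  have "finite {p \<in> S. t \<in> supp p}" for t
  proof (cases "\<exists>p\<in>S. t \<in> supp p")
    case True
    then obtain p where "p \<in> S" "t \<in> supp p" by blast
    then have "{p \<in> S. t \<in> supp p} \<subseteq> {p}"
      using assms(1) unfolding disjoint_blocks_def by blast
    then show ?thesis using finite_subset by blast
  next
    case False
    then have "{p \<in> S. t \<in> supp p} = {}" by blast
    then show ?thesis by (metis finite.emptyI)
  qed
  moreover have "{p \<in> S. supp p \<inter> T \<noteq> {}} = (\<Union>t\<in>T. {p \<in> S. t \<in> supp p})" by blast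
  ultimately show ?thesis using assms(2) by simp
qed

lemma countable_blocks_meeting:
  assumes "disjoint_blocks S" "countable T"
  shows "countable {p \<in> S. supp p \<inter> T \<noteq> {}}"
proof -
  have "countable {p \<in> S. supp p \<inter> {t} \<noteq> {}}" for t
    using finite_blocks_meeting[OF assms(1), of "{t}"] countable_finite by blast
  moreover have "{p \<in> S. supp p \<inter> T \<noteq> {}} = (\<Union>t\<in>T. {p \<in> S. supp p \<inter> {t} \<noteq> {}})" by blast
  ultimately show ?thesis using assms(2) by simp
qed

lemma infinite_blocks_avoiding:
  assumes "disjoint_blocks S" "finite T" "infinite {p \<in> S. P p}"
  obtains p where "p \<in> S" "P p" "supp p \<inter> T = {}"
proof -
  have "infinite ({p \<in> S. P p} - {p \<in> S. supp p \<inter> T \<noteq> {}})"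
    using finite_blocks_meeting[OF assms(1,2)] assms(3) by (rule Diff_infinite_finite)
  then have "\<exists>p. p \<in> {p \<in> S. P p} - {p \<in> S. supp p \<inter> T \<noteq> {}}"
    unfolding ex_in_conv by (rule infinite_imp_nonempty)
  then obtain p where "p \<in> {p \<in> S. P p} - {p \<in> S. supp p \<inter> T \<noteq> {}}" ..
  then have "p \<in> S" "P p" "supp p \<inter> T = {}" by simp_all
  then show ?thesis by (rule that)
qed

text \<open>
  The sets in \<open>\<H>\<close> are the admissible finite approximations to \<open>V\<close>. Every family in \<open>\<C>\<close> is
  treated infinitely often, each time by adding a block disjoint from all blocks used before.
\<close>

lemma generic_set:
  fixes \<C> :: "('a set \<times> 'a set) set set" and \<H> :: "'a set set"
  assumes ctbl: "countable \<C>" and dis: "\<And>S. S \<in> \<C> \<Longrightarrow> disjoint_blocks S"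
    and fin: "\<And>H. H \<in> \<H> \<Longrightarrow> finite H" and empty: "{} \<in> \<H>"
    and ext: "\<And>S H. \<lbrakk>S \<in> \<C>; H \<in> \<H>\<rbrakk> \<Longrightarrow> infinite {p \<in> S. H \<union> fst p \<in> \<H>}"
  obtains V where "\<And>S. S \<in> \<C> \<Longrightarrow> infinite {p \<in> S. satisfies V p}"
    "\<And>H. \<lbrakk>finite H; H \<subseteq> V\<rbrakk> \<Longrightarrow> \<exists>H'\<in>\<H>. H \<subseteq> H'"
proof (cases "\<C> = {}")
  case True
  show ?thesis
    by (rule that[of "{}"]) (use True empty in auto)
next
  case False
  \<comment> \<open>Through the pairing, \<open>r\<close> lists every member of \<open>\<C>\<close>
    infinitely often.\<close>
  define r where "r = (\<lambda>n. from_nat_into \<C> (fst (prod_decode n)))"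
  have r: "r n \<in> \<C>" for n unfolding r_def using False by (simp add: from_nat_into)
  have r_inf: "infinite {n. r n = S}" if "S \<in> \<C>" for S
  proof -
    obtain k where k: "from_nat_into \<C> k = S"
      using from_nat_into_surj[OF ctbl \<open>S \<in> \<C>\<close>] by blast
    have "inj (\<lambda>m. prod_encode (k, m))" by (simp add: inj_on_def)
    then have "infinite (range (\<lambda>m. prod_encode (k, m)))"
      using finite_imageD by blast
    moreover have "range (\<lambda>m. prod_encode (k, m)) \<subseteq> {n. r n = S}"
      by (auto simp: r_def k)
    ultimately show ?thesis using finite_subset by blast
  qed
  \<comment> \<open>In a state \<open>(T, H)\<close>, \<open>T\<close> holds the points whose
    membership in \<open>V\<close> is settled and \<open>H\<close> those of them that are put
    in.\<close>
  define P where "P = (\<lambda>(n::nat) (T, H). finite T \<and> H \<in> \<H> \<and> H \<subseteq> T)"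
  define Q where "Q = (\<lambda>n (T, H) (T', H').
    \<exists>p\<in>r n. supp p \<inter> T = {} \<and> T' = T \<union> supp p \<and> H' = H \<union> fst p)"
  have "\<exists>f. \<forall>n. P n (f n) \<and> Q n (f n) (f (Suc n))"
  proof (rule dependent_nat_choice)
    show "\<exists>x. P 0 x" using empty by (auto simp: P_def)
  next
    fix x n assume "P n x"
    then obtain T H where x: "x = (T, H)" "finite T" "H \<in> \<H>" "H \<subseteq> T"
      by (cases x) (auto simp: P_def)
    obtain p where p: "p \<in> r n" "H \<union> fst p \<in> \<H>" "supp p \<inter> T = {}"
      using infinite_blocks_avoiding[OF dis[OF r] x(2) ext[OF r x(3)]] .
    then have "finite (supp p)" using dis[OF r] by (auto simp: disjoint_blocks_def)
    with p x show "\<exists>y. P (Suc n) y \<and> Q n x y"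
      by (intro exI[of _ "(T \<union> supp p, H \<union> fst p)"]) (auto simp: P_def Q_def supp_def)
  qed
  then obtain f where f: "\<And>n. P n (f n)" "\<And>n. Q n (f n) (f (Suc n))" by blast
  define T where "T = (\<lambda>n. fst (f n))"
  define H where "H = (\<lambda>n. snd (f n))"
  have PH: "H n \<in> \<H>" "H n \<subseteq> T n" for n
    using f(1)[of n] by (auto simp: P_def H_def T_def case_prod_beta)
  have "\<exists>p\<in>r n. supp p \<inter> T n = {} \<and> T (Suc n) = T n \<union> supp p \<and> H (Suc n) = H n \<union> fst p" for n
    using f(2)[of n] by (auto simp: Q_def H_def T_def case_prod_beta)
  then obtain p where p: "\<And>n. p n \<in> r n" "\<And>n. supp (p n) \<inter> T n = {}"
    "\<And>n. T (Suc n) = T n \<union> supp (p n)" "\<And>n. H (Suc n) = H n \<union> fst (p n)" by metis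
  have T_mono: "T m \<subseteq> T n" if "m \<le> n" for m n
    by (rule lift_Suc_mono_le[of T, OF _ that]) (auto simp: p(3))
  have H_mono: "H m \<subseteq> H n" if "m \<le> n" for m n
    by (rule lift_Suc_mono_le[of H, OF _ that]) (auto simp: p(4))
  \<comment> \<open>Blocks added from stage \<open>n\<close> on avoid \<open>T n\<close>, so
    decisions about its points are never revised.\<close>
  have H_T: "H m \<inter> T n \<subseteq> H n" for m n
  proof (cases "m \<le> n")
    case True
    then show ?thesis using H_mono by blast
  next
    case False
    then have "n \<le> m" by simp
    then show ?thesis
    proof (induction m rule: dec_induct)
      case base
      then show ?case by blast
    next
      case (step m)
      have "fst (p m) \<inter> T n = {}"
        using p(2)[of m] T_mono[OF step(1)] by (auto simp: supp_def)
      with step show ?case by (auto simp: p(4))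
    qed
  qed
  define V where "V = (\<Union>n. H n)"
  have sat: "satisfies V (p n)" for n
  proof -
    have "snd (p n) \<inter> H m = {}" for m
    proof -
      have "snd (p n) \<subseteq> T (Suc n)" by (auto simp: p(3) supp_def)
      then have "snd (p n) \<inter> H m \<subseteq> snd (p n) \<inter> (H n \<union> fst (p n))"
        using H_T[of m "Suc n"] p(4) by blast
      moreover have "snd (p n) \<inter> H n = {}"
        using p(2)[of n] PH(2)[of n] by (auto simp: supp_def)
      moreover have "fst (p n) \<inter> snd (p n) = {}"
        using p(1)[of n] dis[OF r] by (auto simp: disjoint_blocks_def)
      ultimately show ?thesis by blast
    qed
    moreover have "fst (p n) \<subseteq> V" using p(4) unfolding V_def by blast
    ultimately show ?thesis unfolding satisfies_def V_def by blast
  qed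
  have p_inj: "inj p"
  proof (rule linorder_injI)
    fix m n :: nat assume "m < n"
    then have "supp (p m) \<subseteq> T n" using T_mono[of "Suc m" n] p(3) by auto
    moreover have "supp (p m) \<noteq> {}" using p(1) dis[OF r] by (auto simp: disjoint_blocks_def)
    ultimately show "p m \<noteq> p n" using p(2)[of n] by auto
  qed
  show ?thesis
  proof (rule that)
    fix S assume "S \<in> \<C>"
    have "infinite (p ` {n. r n = S})"
      using r_inf[OF \<open>S \<in> \<C>\<close>] p_inj finite_imageD inj_on_subset by blast
    moreover have "p ` {n. r n = S} \<subseteq> {p \<in> S. satisfies V p}"
      using p(1) sat by auto
    ultimately show "infinite {p \<in> S. satisfies V p}" using finite_subset by blast
  next
    fix K assume K: "finite K" "K \<subseteq> V"
    then have "\<exists>n. K \<subseteq> H n"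
    proof (induction K)
      case empty
      then show ?case by blast
    next
      case (insert x K)
      then obtain m n where "K \<subseteq> H m" "x \<in> H n" unfolding V_def by blast
      then have "insert x K \<subseteq> H (max m n)" using H_mono[of m "max m n"] H_mono[of n "max m n"] by auto
      then show ?case by blast
    qed
    then show "\<exists>H'\<in>\<H>. K \<subseteq> H'" using PH(1) by blast
  qed
qed

section \<open>The recursive construction\<close>

text \<open>
  The assumption \<open>guess\<close> combines a diamond sequence \<open>A\<close> with the club of all \<open>c\<close> closed under \<open>g\<close>;
  the coding \<open>e\<close> turns guesses into sets of blocks.
\<close>

locale guessing_sequence =
  fixes A :: "'a::wellorder \<Rightarrow> 'a set" and e :: "'a set \<times> 'a set \<Rightarrow> 'a"
  assumes countable_below: "countable {..<a::'a}"
    and uncountable_UNIV: "uncountable (UNIV :: 'a set)"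
    and guess: "(\<And>H. finite H \<Longrightarrow> countable (g H)) \<Longrightarrow>
      \<exists>c. B \<inter> {..<c} = A c \<and> (\<forall>H. finite H \<longrightarrow> H \<subseteq> {..<c} \<longrightarrow> g H \<subseteq> {..<c})"
    and inj_e: "inj_on e {p. finite (supp p)}"
begin

lemma countable_atMost: "countable {..a::'a}"
  by (rule countable_atMost_if_lessThan[OF countable_below])

definition guessed_blocks :: "'a \<Rightarrow> ('a set \<times> 'a set) set" where
  "guessed_blocks a = {p. finite (supp p) \<and> supp p \<subseteq> {..<a} \<and> e p \<in> A a}"

lemma countable_guessed_blocks: "countable (guessed_blocks a)"
proof -
  have "guessed_blocks a \<subseteq> {F. finite F \<and> F \<subseteq> {..<a}} \<times> {F. finite F \<and> F \<subseteq> {..<a}}"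
    by (auto simp: guessed_blocks_def supp_def)
  then show ?thesis
    by (rule countable_subset) (simp add: countable_Collect_finite_subset countable_below)
qed

text \<open>
  The function \<open>f\<close> assigns to \<open>y\<close> the set of all \<open>x < y\<close> with \<open>y \<in> U x\<close>, so that the condition
  \<open>x \<le> h \<or> h \<in> f x\<close> expresses \<open>x \<in> U h\<close>.
\<close>

definition refined :: "('a \<Rightarrow> 'a set) \<Rightarrow> 'a \<Rightarrow> 'a set \<Rightarrow> 'a set \<Rightarrow> ('a set \<times> 'a set) set" where
  "refined f a K H = {p \<in> guessed_blocks a.
     (\<forall>x\<in>fst p. \<forall>h\<in>H. x \<le> h \<or> h \<in> f x) \<and> (\<forall>x\<in>K. satisfies (f x) p)}"

text \<open>The sets \<open>U h\<close> with \<open>h \<in> f a\<close> suffice to describe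
  neighbourhoods of \<open>a\<close> here: any other \<open>U h\<close> containing \<open>a\<close>
  has \<open>a \<le> h\<close> and contains everything below \<open>a\<close>. So the first
  components of the guessed blocks accumulate at \<open>a\<close>, even if only blocks satisfied at
  all points of \<open>K\<close> count.\<close>

definition active :: "('a \<Rightarrow> 'a set) \<Rightarrow> 'a \<Rightarrow> 'a set \<Rightarrow> bool" where
  "active f a K \<longleftrightarrow> disjoint_blocks (guessed_blocks a) \<and>
     (\<forall>H. finite H \<and> H \<subseteq> f a \<longrightarrow> infinite (refined f a K H))"

text \<open>Meeting these at \<open>c\<close> for all \<open>H\<close> is what turns
  \<open>active f a K\<close> into \<open>active f a (insert c K)\<close>.\<close>

definition tasks :: "('a \<Rightarrow> 'a set) \<Rightarrow> 'a \<Rightarrow> ('a set \<times> 'a set) set set" where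
  "tasks f c = {refined f a K H |a K H.
     a < c \<and> finite K \<and> K \<subseteq> {a<..<c} \<and> active f a K \<and> finite H \<and> H \<subseteq> f a}"

definition admissible :: "('a \<Rightarrow> 'a set) \<Rightarrow> 'a \<Rightarrow> 'a set \<Rightarrow> bool" where
  "admissible f c V \<longleftrightarrow> V \<subseteq> {..<c} \<and> (\<forall>S\<in>tasks f c. infinite {p \<in> S. satisfies V p})"

definition accumulates :: "('a \<Rightarrow> 'a set) \<Rightarrow> 'a \<Rightarrow> 'a set \<Rightarrow> bool" where
  "accumulates f c V \<longleftrightarrow> (\<forall>H. finite H \<and> H \<subseteq> V \<longrightarrow> infinite (refined f c {} H))"

text \<open>
  A set \<open>A c\<close> containing the code of the trivial pair is taken as a guess of a set that \<open>U\<close> must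
  not turn into a cover, any other \<open>A c\<close> as a guess of a family of blocks.
\<close>

definition good_step :: "('a \<Rightarrow> 'a set) \<Rightarrow> 'a \<Rightarrow> 'a set \<Rightarrow> bool" where
  "good_step f c V \<longleftrightarrow> admissible f c V \<and>
     (if ({}, {}) \<in> guessed_blocks c
      then (\<exists>V'. admissible f c V' \<and> V' \<inter> A c = {}) \<longrightarrow> V \<inter> A c = {}
      else (\<exists>V'. admissible f c V' \<and> accumulates f c V') \<longrightarrow> accumulates f c V)"

section \<open>Bookkeeping of tasks and solvability of each recursion step\<close>

lemma tasksE:
  assumes "S \<in> tasks f c"
  obtains a K H where "S = refined f a K H" "a < c" "finite K" "K \<subseteq> {a<..<c}"
    "active f a K" "finite H" "H \<subseteq> f a"
proof -
  from assms have "\<exists>a K H. S = refined f a K H \<and> a < c \<and> finite K \<and> K \<subseteq> {a<..<c} \<and>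
    active f a K \<and> finite H \<and> H \<subseteq> f a"
    by (simp only: tasks_def mem_Collect_eq)
  then show ?thesis using that by (elim exE conjE)
qed

lemma refined_subset: "refined f a K H \<subseteq> guessed_blocks a"
  by (auto simp: refined_def)

lemma refined_antimono: "\<lbrakk>K \<subseteq> K'; H \<subseteq> H'\<rbrakk> \<Longrightarrow> refined f a K' H' \<subseteq> refined f a K H"
  unfolding refined_def by blast

lemma active_antimono: "\<lbrakk>active f a K'; K \<subseteq> K'\<rbrakk> \<Longrightarrow> active f a K"
  unfolding active_def using refined_antimono[of K K'] by (metis order_refl infinite_super)

lemma tasks_disjoint_blocks: "S \<in> tasks f c \<Longrightarrow> disjoint_blocks S"
  unfolding tasks_def active_def using disjoint_blocks_subset[OF _ refined_subset] by auto

lemma countable_tasks: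
  assumes "\<And>a. a < c \<Longrightarrow> f a \<subseteq> {..<a}"
  shows "countable (tasks f c)"
proof -
  let ?Fin = "{F. finite F \<and> F \<subseteq> {..<c}}"
  have "tasks f c \<subseteq> (\<lambda>(a, K, H). refined f a K H) ` ({..<c} \<times> ?Fin \<times> ?Fin)"
  proof
    fix S assume "S \<in> tasks f c"
    then obtain a K H where S: "S = refined f a K H" "a < c" "finite K" "K \<subseteq> {a<..<c}"
      "finite H" "H \<subseteq> f a" by (rule tasksE)
    moreover have "f a \<subseteq> {..<c}" using assms[OF S(2)] S(2) by auto
    ultimately have "(a, K, H) \<in> {..<c} \<times> ?Fin \<times> ?Fin" by auto
    then show "S \<in> (\<lambda>(a, K, H). refined f a K H) ` ({..<c} \<times> ?Fin \<times> ?Fin)"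
      using S(1) by (intro image_eqI[of _ _ "(a, K, H)"]) simp_all
  qed
  moreover have "countable ({..<c} \<times> ?Fin \<times> ?Fin)"
    by (simp add: countable_Collect_finite_subset countable_below)
  ultimately show ?thesis by (meson countable_image countable_subset)
qed

text \<open>\<open>generic_set\<close> for the countably many tasks. The choice of
  \<open>\<H>\<close> allows a further demand on the finite subsets of \<open>V\<close>.\<close>

lemma admissible_exists:
  assumes f: "\<And>a. a < c \<Longrightarrow> f a \<subseteq> {..<a}"
    and \<H>: "{} \<in> \<H>" "\<And>H. H \<in> \<H> \<Longrightarrow> finite H \<and> H \<subseteq> {..<c}"
    and ext: "\<And>S H. \<lbrakk>S \<in> tasks f c; H \<in> \<H>\<rbrakk> \<Longrightarrow> infinite {p \<in> S. H \<union> fst p \<in> \<H>}"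
  obtains V where "admissible f c V" "\<And>H. \<lbrakk>finite H; H \<subseteq> V\<rbrakk> \<Longrightarrow> \<exists>H'\<in>\<H>. H \<subseteq> H'"
proof -
  obtain V where V: "\<And>S. S \<in> tasks f c \<Longrightarrow> infinite {p \<in> S. satisfies V p}"
    "\<And>H. \<lbrakk>finite H; H \<subseteq> V\<rbrakk> \<Longrightarrow> \<exists>H'\<in>\<H>. H \<subseteq> H'"
  proof (rule generic_set[of "tasks f c" \<H>])
    show "countable (tasks f c)" by (rule countable_tasks) (rule f)
  qed (use \<H> ext tasks_disjoint_blocks in auto)
  have "x < c" if "x \<in> V" for x
    using V(2)[of "{x}"] \<H>(2) that by fastforce
  then have "admissible f c V" using V(1) by (auto simp: admissible_def)
  with V(2) show ?thesis by (rule that[rotated])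
qed

lemma tasks_infinite: "S \<in> tasks f c \<Longrightarrow> infinite S"
  unfolding tasks_def active_def by blast

lemma tasks_supp: "\<lbrakk>S \<in> tasks f c; p \<in> S\<rbrakk> \<Longrightarrow> finite (supp p) \<and> supp p \<subseteq> {..<c}"
  unfolding tasks_def refined_def guessed_blocks_def by fastforce

text \<open>The extra demands in \<open>good_step\<close> are conditional on their own solvability,
  so it is enough that some admissible set exists. All finite sets below \<open>c\<close> serve as
  approximations.\<close>

lemma good_step_exists:
  assumes "\<And>a. a < c \<Longrightarrow> f a \<subseteq> {..<a}"
  shows "\<exists>V. good_step f c V"
proof -
  obtain V where "admissible f c V"
  proof (rule admissible_exists[of c f "{H. finite H \<and> H \<subseteq> {..<c}}"])
    fix S H assume *: "S \<in> tasks f c" "H \<in> {H. finite H \<and> H \<subseteq> {..<c}}"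
    then have "finite (fst p) \<and> fst p \<subseteq> {..<c}" if "p \<in> S" for p
      using tasks_supp[OF *(1) that] by (simp add: supp_def)
    then have "{p \<in> S. H \<union> fst p \<in> {H. finite H \<and> H \<subseteq> {..<c}}} = S"
      using *(2) by blast
    with * show "infinite {p \<in> S. H \<union> fst p \<in> {H. finite H \<and> H \<subseteq> {..<c}}}"
      using tasks_infinite by simp
  qed (use assms in auto)
  then show ?thesis unfolding good_step_def by (cases "({}, {}) \<in> guessed_blocks c") auto
qed

text \<open>The condition at \<open>c\<close> consults \<open>f\<close> only below \<open>c\<close>,
  as the well-founded choice in \<open>good_sequence_exists\<close> requires.\<close>

lemma good_step_cong:
  assumes fg: "\<And>x. x < c \<Longrightarrow> f x = g x"
  shows "good_step f c = good_step g c"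
proof -
  have ref: "refined f a K H = refined g a K H" if "a \<le> c" "K \<subseteq> {..<c}" for a K H
  proof -
    have "f x = g x" if "p \<in> guessed_blocks a" "x \<in> fst p" for p x
      using that \<open>a \<le> c\<close> by (intro fg) (auto simp: guessed_blocks_def supp_def)
    moreover have "f x = g x" if "x \<in> K" for x using that \<open>K \<subseteq> {..<c}\<close> by (intro fg) auto
    ultimately show ?thesis unfolding refined_def by (intro Collect_cong conj_cong ball_cong) auto
  qed
  have act: "active f a K = active g a K" if "a < c" "K \<subseteq> {..<c}" for a K
    using that by (simp add: active_def ref fg)
  have "S \<in> tasks f c \<longleftrightarrow> S \<in> tasks g c" for S
  proof -
    have "S = refined f a K H \<and> a < c \<and> finite K \<and> K \<subseteq> {a<..<c} \<and> active f a K \<and> finite H \<and> H \<subseteq> f a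
      \<longleftrightarrow> S = refined g a K H \<and> a < c \<and> finite K \<and> K \<subseteq> {a<..<c} \<and> active g a K \<and> finite H \<and> H \<subseteq> g a"
      for a K H
    proof (cases "a < c \<and> K \<subseteq> {a<..<c}")
      case True
      moreover from this have "K \<subseteq> {..<c}" by auto
      ultimately show ?thesis by (simp add: ref act fg less_imp_le)
    qed auto
    then show ?thesis unfolding tasks_def by simp
  qed
  then have "tasks f c = tasks g c" by blast
  then have "admissible f c = admissible g c" by (simp add: admissible_def fun_eq_iff)
  moreover have "accumulates f c = accumulates g c" by (simp add: accumulates_def fun_eq_iff ref)
  ultimately show ?thesis by (simp add: good_step_def fun_eq_iff)
qed

lemma good_sequence_exists: "\<exists>V. \<forall>c. good_step V c (V c)"
proof (rule dependent_wf_choice[OF wf])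
  show "good_step f c V = good_step g c V" if "\<And>z. (z, c) \<in> {(x, y). x < y} \<Longrightarrow> f z = g z" for f g c V
    using good_step_cong[of c f g] that by auto
  show "\<exists>V. good_step f c V" if "\<And>y. (y, c) \<in> {(x, y). x < y} \<Longrightarrow> good_step f y (f y)" for c f
    by (rule good_step_exists) (use that in \<open>auto simp: good_step_def admissible_def\<close>)
qed

end

section \<open>Active guesses, captured blocks and accumulation\<close>

locale good_sequence = guessing_sequence A e for A :: "'a::wellorder \<Rightarrow> 'a set" and e +
  fixes V :: "'a \<Rightarrow> 'a set"
  assumes good: "good_step V c (V c)"
begin

lemma admissible: "admissible V c (V c)"
  using good by (simp add: good_step_def)

lemma V_subset: "V c \<subseteq> {..<c}"
  using admissible by (simp add: admissible_def)

text \<open>Add the points of \<open>K\<close> in increasing order: what the smaller points leave of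
  the guess is a task at the new maximum \<open>b\<close>, and admissibility of \<open>V b\<close>
  keeps infinitely many of its blocks.\<close>

lemma active_if_empty:
  assumes "active V a {}" "finite K" "K \<subseteq> {a<..}"
  shows "active V a K"
  using assms(2,3)
proof (induction K rule: finite_linorder_max_induct)
  case empty
  show ?case by (rule assms(1))
next
  case (insert b K)
  have "infinite (refined V a (insert b K) H)" if H: "finite H" "H \<subseteq> V a" for H
  proof -
    have "refined V a K H \<in> tasks V b"
      unfolding tasks_def
      by (rule CollectI, rule exI[of _ a], rule exI[of _ K], rule exI[of _ H])
        (use insert H in auto)
    then have "infinite {p \<in> refined V a K H. satisfies (V b) p}"
      using admissible[of b] by (simp add: admissible_def)
    moreover have "{p \<in> refined V a K H. satisfies (V b) p} = refined V a (insert b K) H"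
      by (auto simp: refined_def)
    ultimately show ?thesis by simp
  qed
  then show ?case using assms(1) by (simp add: active_def)
qed

text \<open>Plays the part of \<open>refined\<close> for the full family \<open>B\<close>, before it
  is cut off at a guessed \<open>c\<close>.\<close>

definition captured :: "('a set \<times> 'a set) set \<Rightarrow> 'a set \<Rightarrow> ('a set \<times> 'a set) set" where
  "captured B H = {p \<in> B. \<forall>x\<in>fst p. \<forall>h\<in>H. x \<le> h \<or> h \<in> V x}"

text \<open>
  The points of a block \<open>q\<close> far above \<open>a\<close> satisfy infinitely many common blocks \<open>p \<in> S\<close>,
  and \<open>q\<close> is then captured by \<open>H \<union> fst p\<close>. As \<open>S\<close> is countable, one \<open>p\<close> serves for uncountably many \<open>q\<close>.
\<close>

lemma infinite_uncountably_captured: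
  assumes B: "disjoint_blocks B" and S: "S \<in> tasks V c" and H: "uncountable (captured B H)"
  shows "infinite {p \<in> S. uncountable (captured B (H \<union> fst p))}"
proof
  define Q where "Q = {p \<in> S. uncountable (captured B (H \<union> fst p))}"
  assume "finite {p \<in> S. uncountable (captured B (H \<union> fst p))}"
  then have "finite Q" by (simp add: Q_def)
  obtain a K H0 where S_eq: "S = refined V a K H0" "a < c" "finite K" "K \<subseteq> {a<..<c}"
    "active V a K" "finite H0" "H0 \<subseteq> V a" using S by (rule tasksE)
  have "countable S"
    unfolding S_eq(1) by (rule countable_subset[OF refined_subset countable_guessed_blocks])
  define W where "W = (\<Union>p\<in>S - Q. captured B (H \<union> fst p))"
  define L where "L = {q \<in> B. supp q \<inter> {..c} \<noteq> {}}"
  have "countable W"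
    unfolding W_def using \<open>countable S\<close> by (intro countable_UN) (auto simp: Q_def)
  moreover have "countable L"
    unfolding L_def by (rule countable_blocks_meeting[OF B countable_atMost])
  ultimately have "\<not> captured B H \<subseteq> W \<union> L"
    using H countable_subset[of "captured B H" "W \<union> L"] by auto
  then obtain q where q: "q \<in> captured B H" "q \<notin> W" "q \<notin> L" by blast
  have "q \<in> B" using q(1) by (simp add: captured_def)
  then have fin: "finite (fst q)" using B by (auto simp: disjoint_blocks_def supp_def)
  have above: "fst q \<subseteq> {c<..}" using q(3) \<open>q \<in> B\<close> by (auto simp: L_def supp_def not_le)
  have "active V a (K \<union> fst q)"
  proof (rule active_if_empty)
    show "active V a {}" using active_antimono[OF S_eq(5)] by simp
    show "K \<union> fst q \<subseteq> {a<..}" using above S_eq(2,4) by auto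
  qed (use fin S_eq(3) in simp)
  then have "infinite (refined V a (K \<union> fst q) H0)"
    using S_eq(6,7) by (simp add: active_def)
  with \<open>finite Q\<close> obtain p where p: "p \<in> refined V a (K \<union> fst q) H0" "p \<notin> Q"
    by (metis finite_subset subsetI)
  have "p \<in> S" using p(1) refined_antimono[of K "K \<union> fst q" H0 H0] S_eq(1) by auto
  have "fst p \<subseteq> V x" if "x \<in> fst q" for x
    using p(1) that by (auto simp: refined_def satisfies_def)
  then have "q \<in> captured B (H \<union> fst p)" using q(1) by (auto simp: captured_def)
  with \<open>p \<in> S\<close> p(2) q(2) show False by (auto simp: W_def)
qed

text \<open>The approximations are the finite sets \<open>H\<close> capturing uncountably many
  blocks of \<open>B\<close>; \<open>infinite_uncountably_captured\<close> extends them for every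
  task. As \<open>c\<close> is closed under \<open>g\<close>, infinitely many captured blocks lie
  below \<open>c\<close>, so the resulting \<open>V'\<close> makes the guess accumulate, and
  \<open>good_step\<close> passes this on to \<open>V c\<close>.\<close>

lemma accumulating_guess:
  assumes B: "disjoint_blocks B" "uncountable B"
  obtains c where "accumulates V c (V c)" "disjoint_blocks (guessed_blocks c)" "guessed_blocks c \<subseteq> B"
proof -
  have "\<exists>Z. Z \<subseteq> captured B H \<and> countable Z \<and> (uncountable (captured B H) \<longrightarrow> infinite Z)" for H
    using infinite_countable_subset'[of "captured B H"] uncountable_infinite by blast
  then obtain Z where Z: "\<And>H. Z H \<subseteq> captured B H" "\<And>H. countable (Z H)"
    "\<And>H. uncountable (captured B H) \<Longrightarrow> infinite (Z H)" by metis
  \<comment> \<open>The first part keeps codes of blocks below \<open>c\<close> below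
    \<open>c\<close>, so that the guess recovers all these blocks of \<open>B\<close>. The second
    keeps the witnesses \<open>Z H\<close> below \<open>c\<close>.\<close>
  define g where "g = (\<lambda>H. e ` (Pow H \<times> Pow H) \<union> (\<Union>p\<in>Z H. supp p))"
  have "countable (g H)" if "finite H" for H
  proof -
    have "countable (supp p)" if "p \<in> Z H" for p
      using that Z(1)[of H] B(1) by (auto simp: captured_def disjoint_blocks_def intro: countable_finite)
    then have "countable (\<Union>p\<in>Z H. supp p)" using Z(2) by blast
    then show ?thesis using that by (simp add: g_def countable_finite)
  qed
  from guess[of g "e ` B", OF this] obtain c where c: "e ` B \<inter> {..<c} = A c"
    "\<And>H. \<lbrakk>finite H; H \<subseteq> {..<c}\<rbrakk> \<Longrightarrow> g H \<subseteq> {..<c}" by blast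
  have B_fin: "B \<subseteq> {p. finite (supp p)}" using B(1) by (auto simp: disjoint_blocks_def)
  have guessed: "guessed_blocks c = {p \<in> B. supp p \<subseteq> {..<c}}"
  proof (intro set_eqI iffI)
    fix p assume p: "p \<in> guessed_blocks c"
    then have "e p \<in> e ` B" using c(1) unfolding guessed_blocks_def by blast
    then obtain q where "q \<in> B" "e p = e q" by blast
    moreover have "finite (supp p)" using p by (simp add: guessed_blocks_def)
    ultimately have "p = q" using B_fin by (intro inj_onD[OF inj_e]) auto
    then show "p \<in> {p \<in> B. supp p \<subseteq> {..<c}}" using \<open>q \<in> B\<close> p by (simp add: guessed_blocks_def)
  next
    fix p assume p: "p \<in> {p \<in> B. supp p \<subseteq> {..<c}}"
    then have "finite (supp p)" using B_fin by auto
    moreover have "p \<in> Pow (supp p) \<times> Pow (supp p)" by (cases p) (auto simp: supp_def)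
    then have "e p \<in> g (supp p)" by (simp add: g_def)
    then have "e p \<in> {..<c}" using c(2) p \<open>finite (supp p)\<close> by blast
    ultimately show "p \<in> guessed_blocks c" using p c(1) by (auto simp: guessed_blocks_def)
  qed
  define \<H> where "\<H> = {H. finite H \<and> H \<subseteq> {..<c} \<and> uncountable (captured B H)}"
  obtain V' where V': "admissible V c V'" "\<And>H. \<lbrakk>finite H; H \<subseteq> V'\<rbrakk> \<Longrightarrow> \<exists>H'\<in>\<H>. H \<subseteq> H'"
  proof (rule admissible_exists[of c V \<H>])
    show "{} \<in> \<H>" using B(2) by (simp add: \<H>_def captured_def)
    show "infinite {p \<in> S. H \<union> fst p \<in> \<H>}" if "S \<in> tasks V c" "H \<in> \<H>" for S H
    proof -
      have "{p \<in> S. H \<union> fst p \<in> \<H>} = {p \<in> S. uncountable (captured B (H \<union> fst p))}"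
        using that tasks_supp[OF that(1)] by (auto simp: \<H>_def supp_def)
      moreover have "uncountable (captured B H)" using that(2) by (simp add: \<H>_def)
      ultimately show ?thesis
        using infinite_uncountably_captured[OF B(1) that(1)] by simp
    qed
  qed (use V_subset in \<open>auto simp: \<H>_def\<close>)
  have "infinite (refined V c {} H)" if H: "finite H" "H \<subseteq> V'" for H
  proof -
    obtain H' where H': "H' \<in> \<H>" "H \<subseteq> H'" using V'(2)[OF H] by blast
    have "Z H' \<subseteq> refined V c {} H"
    proof
      fix p assume p: "p \<in> Z H'"
      then have "supp p \<subseteq> g H'" by (auto simp: g_def)
      then have "supp p \<subseteq> {..<c}" using c(2) H'(1) unfolding \<H>_def by blast
      moreover have "p \<in> captured B H'" using p Z(1) by blast
      ultimately show "p \<in> refined V c {} H"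
        using H'(2) by (auto simp: refined_def captured_def guessed)
    qed
    moreover have "infinite (Z H')" using H'(1) Z(3) by (simp add: \<H>_def)
    ultimately show ?thesis by (rule infinite_super)
  qed
  then have "accumulates V c V'" by (simp add: accumulates_def)
  \<comment> \<open>The guess is unmarked, so the accumulation alternative of
    \<open>good_step\<close> applies.\<close>
  moreover have "({}, {}) \<notin> guessed_blocks c"
    using B(1) unfolding guessed by (auto simp: disjoint_blocks_def supp_def)
  ultimately have "accumulates V c (V c)" using good[of c] V'(1) by (auto simp: good_step_def)
  moreover have "guessed_blocks c \<subseteq> B" by (auto simp: guessed)
  ultimately show ?thesis using that disjoint_blocks_subset[OF B(1)] by blast
qed

text \<open>An accumulating guess is active, and by \<open>active_if_empty\<close> it stays so with
  \<open>K = {y}\<close> for every later \<open>y\<close>; any remaining block will do.\<close>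

lemma tail_satisfies:
  assumes "disjoint_blocks B" "uncountable B"
  obtains c where "\<And>y. c < y \<Longrightarrow> \<exists>p\<in>B. supp p \<subseteq> {..<c} \<and> satisfies (V y) p"
proof -
  obtain c where c: "accumulates V c (V c)" "disjoint_blocks (guessed_blocks c)" "guessed_blocks c \<subseteq> B"
    using accumulating_guess[OF assms] .
  show ?thesis
  proof (rule that)
    fix y assume "c < y"
    have "active V c {}" using c(1,2) by (simp add: active_def accumulates_def)
    then have "active V c {y}" using \<open>c < y\<close> active_if_empty[of c "{y}"] by simp
    then have "infinite (refined V c {y} {})" by (simp add: active_def)
    then have "refined V c {y} {} \<noteq> {}" by (rule infinite_imp_nonempty)
    then obtain p where "p \<in> refined V c {y} {}" by blast
    then show "\<exists>p\<in>B. supp p \<subseteq> {..<c} \<and> satisfies (V y) p"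
      using c(3) by (auto simp: refined_def guessed_blocks_def)
  qed
qed

section \<open>The sets \<open>U x\<close> and their covering properties\<close>

definition U :: "'a \<Rightarrow> 'a set" where
  "U x = {y. y \<le> x \<or> x \<in> V y}"

text \<open>
  If a task at \<open>c\<close> stemming from \<open>a\<close> had almost all its blocks meet \<open>D\<close>, then \<open>D\<close> would accumulate at \<open>a\<close>.
\<close>

lemma locally_finite_not_cover:
  assumes "countable D"
    and lf: "\<And>z. \<exists>F. finite F \<and> z \<in> (\<Inter>x\<in>F. U x) \<and> finite (D \<inter> (\<Inter>x\<in>F. U x))"
  obtains y where "\<And>x. x \<in> D \<Longrightarrow> y \<notin> U x"
proof -
  \<comment> \<open>The code of \<open>({}, {})\<close> marks the guess as a set to be
    avoided.\<close>
  define D1 where "D1 = insert (e ({}, {})) D"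
  have "countable D1" using assms(1) by (simp add: D1_def)
  \<comment> \<open>Closure under a constant function, tested at \<open>H = {}\<close>, forces all
    of \<open>D1\<close> below \<open>c\<close>.\<close>
  from guess[of "\<lambda>H. D1" D1, OF this] obtain c where c: "D1 \<inter> {..<c} = A c"
    "\<forall>H. finite H \<longrightarrow> H \<subseteq> {..<c} \<longrightarrow> D1 \<subseteq> {..<c}" by blast
  from c(2)[rule_format, of "{}"] have D1_below: "D1 \<subseteq> {..<c}" by simp
  with c(1) have A_c: "A c = D1" by blast
  \<comment> \<open>Every singleton from \<open>V'\<close> will lie in such an approximation, so
    \<open>V'\<close> misses \<open>D1\<close>.\<close>
  define \<H> where "\<H> = {H. finite H \<and> H \<subseteq> {..<c} \<and> H \<inter> D1 = {}}"
  obtain V' where V': "admissible V c V'" "\<And>H. \<lbrakk>finite H; H \<subseteq> V'\<rbrakk> \<Longrightarrow> \<exists>H'\<in>\<H>. H \<subseteq> H'"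
  proof (rule admissible_exists[of c V \<H>])
    show "infinite {p \<in> S. H \<union> fst p \<in> \<H>}" if S: "S \<in> tasks V c" and H: "H \<in> \<H>" for S H
    proof
      assume fin: "finite {p \<in> S. H \<union> fst p \<in> \<H>}"
      have "{p \<in> S. H \<union> fst p \<in> \<H>} = {p \<in> S. fst p \<inter> D1 = {}}"
        using H tasks_supp[OF S] by (auto simp: \<H>_def supp_def)
      with fin have fin: "finite {p \<in> S. fst p \<inter> D1 = {}}" by simp
      from S obtain a K H0 where S_eq: "S = refined V a K H0" "a < c" "finite K" "K \<subseteq> {a<..<c}"
        "active V a K" "finite H0" "H0 \<subseteq> V a" by (rule tasksE)
      obtain F where F: "finite F" "a \<in> (\<Inter>x\<in>F. U x)" "finite (D \<inter> (\<Inter>x\<in>F. U x))"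
        using lf by blast
      define T where "T = D1 \<inter> (\<Inter>x\<in>F. U x)"
      have "finite T" using F(3) by (simp add: T_def D1_def Int_insert_left)
      \<comment> \<open>For \<open>h \<in> F - V a\<close>, \<open>a \<in> U h\<close> means
        \<open>a \<le> h\<close>, so \<open>U h\<close> contains all blocks guessed at
        \<open>a\<close>. Only the \<open>h \<in> V a\<close> impose a condition, and adding them to
        \<open>H0\<close> puts the first components into the neighbourhood of \<open>a\<close> given
        by \<open>F\<close>.\<close>
      define H1 where "H1 = H0 \<union> (F \<inter> V a)"
      have inf: "infinite (refined V a K H1)"
        using S_eq(5-7) F(1) by (simp add: active_def H1_def)
      have sub: "refined V a K H1 \<subseteq> {p \<in> S. fst p \<inter> D1 = {}} \<union> {p \<in> S. supp p \<inter> T \<noteq> {}}"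
      proof
        fix p assume p: "p \<in> refined V a K H1"
        then have "p \<in> S" using refined_antimono[of K K H0 H1] S_eq(1) by (auto simp: H1_def)
        have "fst p \<subseteq> (\<Inter>x\<in>F. U x)"
        proof (intro subsetI INT_I)
          fix x h assume "x \<in> fst p" "h \<in> F"
          show "x \<in> U h"
          proof (cases "h \<in> V a")
            case True
            then have "h \<in> H1" using \<open>h \<in> F\<close> by (simp add: H1_def)
            then show ?thesis using p \<open>x \<in> fst p\<close> by (auto simp: refined_def U_def)
          next
            case False
            have "a \<in> U h" using F(2) \<open>h \<in> F\<close> by blast
            with False have "a \<le> h" by (simp add: U_def)
            moreover have "x < a"
              using p \<open>x \<in> fst p\<close> by (auto simp: refined_def guessed_blocks_def supp_def)
            ultimately have "x \<le> h" by simp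
            then show ?thesis by (simp add: U_def)
          qed
        qed
        then show "p \<in> {p \<in> S. fst p \<inter> D1 = {}} \<union> {p \<in> S. supp p \<inter> T \<noteq> {}}"
          using \<open>p \<in> S\<close> by (auto simp: T_def supp_def)
      qed
      have "finite {p \<in> S. supp p \<inter> T \<noteq> {}}"
        by (rule finite_blocks_meeting[OF tasks_disjoint_blocks[OF S] \<open>finite T\<close>])
      with fin have "finite (refined V a K H1)" by (intro finite_subset[OF sub]) simp
      with inf show False ..
    qed
  qed (use V_subset in \<open>auto simp: \<H>_def\<close>)
  have "x \<notin> D1" if "x \<in> V'" for x
    using V'(2)[of "{x}"] that by (auto simp: \<H>_def)
  then have "V' \<inter> A c = {}" using A_c by blast
  moreover have "({}, {}) \<in> guessed_blocks c"
    using A_c by (simp add: guessed_blocks_def supp_def D1_def)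
  ultimately have "V c \<inter> A c = {}" using V'(1) good[of c] by (auto simp: good_step_def)
  show ?thesis
  proof (rule that)
    fix x assume "x \<in> D"
    then have "x \<in> A c" "x < c" using A_c D1_below by (auto simp: D1_def)
    then show "c \<notin> U x" using \<open>V c \<inter> A c = {}\<close> by (auto simp: U_def)
  qed
qed

text \<open>
  If this fails, there are points \<open>z a \<ge> a\<close> in \<open>S\<close> outside \<open>nb x\<close> for all \<open>x \<in> S\<close> below \<open>a\<close>. Thinned out
  to a Delta-system, their basic sets form a block family to which \<open>tail_satisfies\<close> applies.
\<close>

lemma countable_subcover:
  fixes F G W :: "'a \<Rightarrow> 'a set"
  defines "nb \<equiv> \<lambda>x. {y \<in> W x. (\<forall>h\<in>F x. y \<in> U h) \<and> (\<forall>h\<in>G x. y \<notin> U h)}"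
  assumes W: "countable (range W)" and fin: "\<And>x. x \<in> S \<Longrightarrow> finite (F x) \<and> finite (G x)"
    and nb: "\<And>x. x \<in> S \<Longrightarrow> x \<in> nb x"
  shows "\<exists>T\<subseteq>S. countable T \<and> S \<subseteq> (\<Union>x\<in>T. nb x)"
proof (rule ccontr)
  assume neg: "\<not> ?thesis"
  have "\<exists>z. z \<in> S \<and> (\<forall>x\<in>S. x < a \<longrightarrow> z \<notin> nb x)" for a
  proof -
    have "countable (S \<inter> {..<a})" using countable_below by (simp add: countable_Int2)
    with neg have "\<not> S \<subseteq> (\<Union>x\<in>S \<inter> {..<a}. nb x)" by (meson inf_le1)
    then show ?thesis by blast
  qed
  then obtain z where z: "\<And>a. z a \<in> S" "\<And>a x. \<lbrakk>x \<in> S; x < a\<rbrakk> \<Longrightarrow> z a \<notin> nb x" by metis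
  have z_ge: "a \<le> z a" for a using z nb by (meson not_le)
  define M where "M = range z"
  have "uncountable M"
  proof
    assume "countable M"
    then have "countable (\<Union>m\<in>M. {..m})" by (simp add: countable_atMost)
    moreover have "(\<Union>m\<in>M. {..m}) = UNIV" using z_ge by (auto simp: M_def)
    ultimately show False using uncountable_UNIV by simp
  qed
  have "M \<subseteq> S" using z(1) by (auto simp: M_def)
  \<comment> \<open>Including \<open>x\<close> keeps the blocks nonempty and makes
    \<open>x < c\<close> follow once the block of \<open>x\<close> lies below
    \<open>c\<close>.\<close>
  define E where "E = (\<lambda>x. insert x (F x \<union> G x))"
  have "\<exists>R N. finite R \<and> N \<subseteq> M \<and> uncountable N \<and>
    (\<forall>x\<in>N. \<forall>y\<in>N. x \<noteq> y \<longrightarrow> (E x - R) \<inter> (E y - R) = {})"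
    by (rule delta_system[OF \<open>uncountable M\<close>]) (use fin \<open>M \<subseteq> S\<close> in \<open>auto simp: E_def\<close>)
  then obtain R N where R: "finite R" "N \<subseteq> M" "uncountable N"
    "\<forall>x\<in>N. \<forall>y\<in>N. x \<noteq> y \<longrightarrow> (E x - R) \<inter> (E y - R) = {}" by (elim exE conjE)
  have "uncountable (N - R)" using R(1,3) by (simp add: countable_finite uncountable_minus_countable)
  \<comment> \<open>The traces on the root and the sets \<open>W x\<close> take only countably many
    values, so they can be made constant. Only the conditions outside \<open>R\<close> are left to
    the blocks.\<close>
  define t where "t = (\<lambda>x. (F x \<inter> R, G x \<inter> R, W x))"
  have "t ` (N - R) \<subseteq> Pow R \<times> Pow R \<times> range W" by (auto simp: t_def)
  moreover have "countable (Pow R \<times> Pow R \<times> range W)"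
    using R(1) W by (intro countable_SIGMA) (simp_all add: countable_finite)
  ultimately have "countable (t ` (N - R))" by (rule countable_subset)
  from uncountable_fibre[OF \<open>uncountable (N - R)\<close> this] obtain k
    where k: "uncountable {x \<in> N - R. t x = k}" ..
  define N2 where "N2 = {x \<in> N - R. t x = k}"
  have N2: "uncountable N2" "N2 \<subseteq> N" "N2 \<subseteq> S" "\<And>x. x \<in> N2 \<Longrightarrow> x \<notin> R"
    "\<And>x y. \<lbrakk>x \<in> N2; y \<in> N2\<rbrakk> \<Longrightarrow> t x = t y"
    using k R(2) \<open>M \<subseteq> S\<close> by (auto simp: N2_def)
  define b where "b = (\<lambda>x. (insert x (F x) - R, G x - R))"
  have supp_b: "supp (b x) = E x - R" for x by (auto simp: b_def supp_def E_def)
  have x_b: "x \<in> supp (b x)" if "x \<in> N2" for x using N2(4)[OF that] by (simp add: supp_b E_def)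
  have disj: "supp (b x) \<inter> supp (b y) = {}" if "x \<in> N2" "y \<in> N2" "x \<noteq> y" for x y
    using R(4) N2(2) that by (simp add: supp_b subset_iff)
  have "inj_on b N2" using disj x_b by (intro inj_onI) (metis Int_absorb empty_iff)
  then have "uncountable (b ` N2)" using N2(1) by (metis countable_image_inj_eq)
  have "disjoint_blocks (b ` N2)"
    unfolding disjoint_blocks_def
  proof (intro conjI ballI impI)
    fix p assume "p \<in> b ` N2"
    then obtain x where x: "p = b x" "x \<in> N2" by blast
    then have "x \<in> S" using N2(3) by blast
    have "x \<in> U x" by (simp add: U_def)
    then show "fst p \<inter> snd p = {}" using nb[OF \<open>x \<in> S\<close>] x by (auto simp: b_def nb_def)
    show "finite (supp p)" using fin[OF \<open>x \<in> S\<close>] by (simp add: x(1) supp_b E_def)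
    show "supp p \<noteq> {}" using x_b x by blast
  next
    fix p q assume "p \<in> b ` N2" "q \<in> b ` N2" "p \<noteq> q"
    then show "supp p \<inter> supp q = {}" using disj by blast
  qed
  from tail_satisfies[OF this \<open>uncountable (b ` N2)\<close>] obtain c
    where c: "\<And>y. c < y \<Longrightarrow> \<exists>p\<in>b ` N2. supp p \<subseteq> {..<c} \<and> satisfies (V y) p" by blast
  \<comment> \<open>Some \<open>y \<in> N2\<close> is therefore \<open>z a\<close> with
    \<open>c < a\<close>. It satisfies a block \<open>b x\<close> with \<open>x < c\<close>, which
    puts \<open>y\<close> into \<open>nb x\<close>, whereas \<open>z a\<close> was chosen outside
    \<open>nb x\<close>.\<close>
  have "\<not> N2 \<subseteq> z ` {..c}" 
    using N2(1) countable_subset[of N2 "z ` {..c}"] countable_atMost by auto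
  then obtain y where y: "y \<in> N2" "y \<notin> z ` {..c}" by blast
  then obtain a where a: "y = z a" using N2(2) R(2) by (auto simp: M_def)
  with y have "c < a" by (metis atMost_iff image_eqI not_le)
  then have "c < y" using z_ge a by (metis less_le_trans)
  obtain x where x: "x \<in> N2" "supp (b x) \<subseteq> {..<c}" "satisfies (V y) (b x)"
    using c[OF \<open>c < y\<close>] by blast
  have "x < c" using x_b x by blast
  have nby: "y \<in> nb y" and "t x = t y" using nb N2(3,5) x(1) y(1) by blast+
  have "y \<in> nb x"
    unfolding nb_def
  proof (intro CollectI conjI ballI)
    show "y \<in> W x" using nby \<open>t x = t y\<close> by (simp add: nb_def t_def)
  next
    fix h assume h: "h \<in> F x"
    show "y \<in> U h"
    proof (cases "h \<in> R")
      case True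
      then have "h \<in> F y" using h \<open>t x = t y\<close> by (auto simp: t_def)
      then show ?thesis using nby by (simp add: nb_def)
    next
      case False
      then have "h \<in> V y" using h x(3) by (auto simp: satisfies_def b_def)
      then show ?thesis by (simp add: U_def)
    qed
  next
    fix h assume h: "h \<in> G x"
    show "y \<notin> U h"
    proof (cases "h \<in> R")
      case True
      then have "h \<in> G y" using h \<open>t x = t y\<close> by (auto simp: t_def)
      then show ?thesis using nby by (simp add: nb_def)
    next
      case False
      then have "h \<in> snd (b x)" using h by (simp add: b_def)
      then have "h \<notin> V y" "h < c" using x(2,3) by (auto simp: satisfies_def supp_def)
      then show ?thesis using \<open>c < y\<close> by (simp add: U_def)
    qed
  qed
  moreover have "x < a" using \<open>x < c\<close> \<open>c < a\<close> by simp
  ultimately show False using z(2) N2(3) x(1) a by blast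
qed

end

section \<open>The space\<close>

context good_sequence
begin

text \<open>
  Declaring \<open>{y. n \<in> \<iota> y}\<close> clopen for every \<open>n\<close> separates the points. As only countably many
  sets are added, the space remains hereditarily Lindelof.
\<close>

lemma space_exists:
  fixes \<iota> :: "'a \<Rightarrow> nat set"
  assumes inj: "inj \<iota>"
  shows "\<exists>X :: nat set topology.
    zero_dimensional_space X \<and> Hausdorff_space X \<and> hereditarily_Lindelof_space X \<and>
    \<not> strongly_D_space X"
proof -
  define nb where "nb = (\<lambda>F G I J.
    {y. (\<forall>h\<in>F. y \<in> U h) \<and> (\<forall>h\<in>G. y \<notin> U h) \<and> I \<subseteq> \<iota> y \<and> J \<inter> \<iota> y = {}})"
  define Base where "Base = (\<lambda>T. \<exists>F G I J.
    finite F \<and> finite G \<and> finite I \<and> finite J \<and> T = \<iota> ` nb F G I J)"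
  define X where "X = topology (arbitrary union_of Base)"
  have BaseI: "Base (\<iota> ` nb F G I J)" if "finite F" "finite G" "finite I" "finite J" for F G I J
    using that unfolding Base_def by blast
  have "istopology (arbitrary union_of Base)"
  proof (rule istopology_base)
    fix S T assume "Base S" "Base T"
    then obtain F G I J F' G' I' J' where
      fin: "finite F" "finite G" "finite I" "finite J" "finite F'" "finite G'" "finite I'" "finite J'"
      and S: "S = \<iota> ` nb F G I J" and T: "T = \<iota> ` nb F' G' I' J'"
      unfolding Base_def by (elim exE conjE)
    have "nb F G I J \<inter> nb F' G' I' J' = nb (F \<union> F') (G \<union> G') (I \<union> I') (J \<union> J')"
      unfolding nb_def by blast
    then have "S \<inter> T = \<iota> ` nb (F \<union> F') (G \<union> G') (I \<union> I') (J \<union> J')"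
      unfolding S T by (simp add: image_Int[OF inj, symmetric])
    then show "Base (S \<inter> T)" using fin by (simp add: BaseI)
  qed
  then have openin_X: "openin X = arbitrary union_of Base"
    unfolding X_def by (rule topology_inverse')
  have openin_Base: "openin X T" if "Base T" for T
    unfolding openin_X using that by (rule arbitrary_union_of_inc)
  have openin_D: "\<exists>F G I J. finite F \<and> finite G \<and> finite I \<and> finite J \<and> y \<in> nb F G I J \<and> \<iota> ` nb F G I J \<subseteq> T"
    if "openin X T" "\<iota> y \<in> T" for T y
  proof -
    obtain B where B: "Base B" "\<iota> y \<in> B" "B \<subseteq> T"
      using \<open>openin X T\<close> \<open>\<iota> y \<in> T\<close> unfolding openin_X arbitrary_union_of_alt by blast
    then obtain F G I J where "finite F" "finite G" "finite I" "finite J" "B = \<iota> ` nb F G I J"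
      unfolding Base_def by (elim exE conjE)
    moreover from this have "y \<in> nb F G I J" using B(2) by (simp add: inj_image_mem_iff[OF inj])
    ultimately show ?thesis using B(3)
      by (intro exI[of _ F] exI[of _ G] exI[of _ I] exI[of _ J]) simp
  qed
  have "nb {} {} {} {} = UNIV" by (simp add: nb_def)
  then have "openin X (range \<iota>)" using openin_Base[OF BaseI, of "{}" "{}" "{}" "{}"] by simp
  moreover have "T \<subseteq> range \<iota>" if T: "openin X T" for T
  proof
    fix p assume "p \<in> T"
    then obtain B where "Base B" "p \<in> B"
      using T unfolding openin_X arbitrary_union_of_alt by blast
    then show "p \<in> range \<iota>" unfolding Base_def by blast
  qed
  ultimately have topspace_X: "topspace X = range \<iota>"
    by (meson openin_subset openin_topspace subset_antisym)
  have closedin_Base: "closedin X T" if "Base T" for T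
  proof -
    obtain F G I J where T: "T = \<iota> ` nb F G I J"
      using \<open>Base T\<close> unfolding Base_def by (elim exE conjE)
    have "\<exists>B. Base B \<and> p \<in> B \<and> B \<subseteq> topspace X - T" if p: "p \<in> topspace X - T" for p
    proof -
      obtain y where y: "p = \<iota> y" "y \<notin> nb F G I J" using p T topspace_X by blast
      have *: ?thesis if "finite F'" "finite G'" "finite I'" "finite J'" "y \<in> nb F' G' I' J'"
        "nb F' G' I' J' \<inter> nb F G I J = {}" for F' G' I' J'
      proof (intro exI conjI)
        show "Base (\<iota> ` nb F' G' I' J')" using that by (intro BaseI)
        show "p \<in> \<iota> ` nb F' G' I' J'" using y(1) that(5) by simp
        show "\<iota> ` nb F' G' I' J' \<subseteq> topspace X - T"
          using that(6) unfolding T topspace_X by (auto dest: injD[OF inj])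
      qed
      \<comment> \<open>Whichever condition fails at \<open>y\<close>, its single opposite condition
        defines a basic set around \<open>y\<close> missing \<open>T\<close>.\<close>
      consider h where "h \<in> F" "y \<notin> U h" | h where "h \<in> G" "y \<in> U h"
        | n where "n \<in> I" "n \<notin> \<iota> y" | n where "n \<in> J" "n \<in> \<iota> y"
        using y(2) unfolding nb_def by blast
      then show ?thesis
      proof cases
        case 1
        then show ?thesis by (intro *[of "{}" "{h}" "{}" "{}"]) (auto simp: nb_def)
      next
        case 2
        then show ?thesis by (intro *[of "{h}" "{}" "{}" "{}"]) (auto simp: nb_def)
      next
        case 3
        then show ?thesis by (intro *[of "{}" "{}" "{}" "{n}"]) (auto simp: nb_def)
      next
        case 4
        then show ?thesis by (intro *[of "{}" "{}" "{n}" "{}"]) (auto simp: nb_def)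
      qed
    qed
    then have "openin X (topspace X - T)" unfolding openin_X arbitrary_union_of_alt by blast
    moreover have "T \<subseteq> topspace X" by (auto simp: T topspace_X)
    ultimately show ?thesis by (simp add: closedin_def)
  qed
  have "zero_dimensional_space X"
    unfolding zero_dimensional_space_def
  proof (intro exI[of _ "Collect Base"] conjI ballI)
    show "openin X = arbitrary union_of (\<lambda>U. U \<in> Collect Base)" by (simp add: openin_X)
  qed (simp_all add: openin_Base closedin_Base)
  moreover have "Hausdorff_space X"
    unfolding Hausdorff_space_def
  proof (intro allI impI)
    fix p q assume "p \<in> topspace X \<and> q \<in> topspace X \<and> p \<noteq> q"
    then obtain x y where xy: "p = \<iota> x" "q = \<iota> y" "\<iota> x \<noteq> \<iota> y" using topspace_X by auto
    define P where "P = (\<lambda>n. \<iota> ` nb {} {} {n} {})"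
    define N where "N = (\<lambda>n. \<iota> ` nb {} {} {} {n})"
    have op: "openin X (P n)" "openin X (N n)" for n
      unfolding P_def N_def by (intro openin_Base BaseI; simp)+
    have dj: "disjnt (P n) (N n)" "disjnt (N n) (P n)" for n
      by (auto simp: P_def N_def disjnt_def nb_def dest: injD[OF inj])
    have PN: "\<iota> z \<in> P n \<longleftrightarrow> n \<in> \<iota> z" "\<iota> z \<in> N n \<longleftrightarrow> n \<notin> \<iota> z" for z n
      by (simp_all add: P_def N_def inj_image_mem_iff[OF inj] nb_def)
    obtain n where "n \<in> \<iota> x \<longleftrightarrow> n \<notin> \<iota> y" using xy(3) by blast
    then show "\<exists>V W. openin X V \<and> openin X W \<and> p \<in> V \<and> q \<in> W \<and> disjnt V W"
      using op dj PN unfolding xy(1,2) by (cases "n \<in> \<iota> x") metis+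
  qed
  moreover have "hereditarily_Lindelof_space X"
    unfolding hereditarily_Lindelof_space_def
  proof (intro allI impI)
    fix S0 assume S0: "S0 \<subseteq> topspace X"
    define S where "S = \<iota> -` S0"
    have S0_eq: "S0 = \<iota> ` S" using S0 topspace_X by (auto simp: S_def)
    show "Lindelof_space (subtopology X S0)"
      unfolding Lindelof_space_subtopology_subset[OF S0]
    proof (intro allI impI)
      fix \<U> assume \<U>: "(\<forall>T\<in>\<U>. openin X T) \<and> S0 \<subseteq> \<Union>\<U>"
      have "\<exists>M F G I J. finite F \<and> finite G \<and> finite I \<and> finite J \<and>
        (y \<in> S \<longrightarrow> M \<in> \<U> \<and> y \<in> nb F G I J \<and> \<iota> ` nb F G I J \<subseteq> M)" for y
      proof (cases "y \<in> S")
        case True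
        then obtain M where "M \<in> \<U>" "\<iota> y \<in> M" using \<U> S0_eq by blast
        then show ?thesis using openin_D[of M y] \<U> by metis
      next
        case False
        then show ?thesis by blast
      qed
      then obtain M F G I J where
        fin: "\<And>y. finite (F y)" "\<And>y. finite (G y)" "\<And>y. finite (I y)" "\<And>y. finite (J y)"
        and M: "\<And>y. y \<in> S \<Longrightarrow> M y \<in> \<U> \<and> y \<in> nb (F y) (G y) (I y) (J y) \<and>
          \<iota> ` nb (F y) (G y) (I y) (J y) \<subseteq> M y"
        by metis
      \<comment> \<open>There are only countably many pairs of finite sets of naturals, so the
        conditions on \<open>\<iota> y\<close> can enter \<open>countable_subcover\<close> through
        its parameter \<open>W\<close>.\<close>
      define W where "W = (\<lambda>x. {y. I x \<subseteq> \<iota> y \<and> J x \<inter> \<iota> y = {}})"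
      have nb_W: "nb (F x) (G x) (I x) (J x) =
        {y \<in> W x. (\<forall>h\<in>F x. y \<in> U h) \<and> (\<forall>h\<in>G x. y \<notin> U h)}" for x
        unfolding nb_def W_def by blast
      have "range W \<subseteq> (\<lambda>(I, J). {y. I \<subseteq> \<iota> y \<and> J \<inter> \<iota> y = {}}) ` (Collect finite \<times> Collect finite)"
        using fin(3,4) by (auto simp: W_def image_iff)
      moreover have "countable (Collect finite \<times> Collect finite :: (nat set \<times> nat set) set)"
        by (simp add: countable_Collect_finite)
      ultimately have "countable (range W)" by (meson countable_image countable_subset)
      then have "\<exists>T\<subseteq>S. countable T \<and> S \<subseteq> (\<Union>x\<in>T. nb (F x) (G x) (I x) (J x))"
        unfolding nb_W by (rule countable_subcover) (use fin M nb_W in auto)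
      then obtain T where T: "T \<subseteq> S" "countable T" "S \<subseteq> (\<Union>x\<in>T. nb (F x) (G x) (I x) (J x))"
        by (elim exE conjE)
      have "S0 \<subseteq> \<Union>(M ` T)"
      proof
        fix p assume "p \<in> S0"
        then obtain y where "p = \<iota> y" "y \<in> S" using S0_eq by blast
        moreover from this obtain x where "x \<in> T" "y \<in> nb (F x) (G x) (I x) (J x)" using T(3) by blast
        ultimately show "p \<in> \<Union>(M ` T)" using M[of x] T(1) by blast
      qed
      then show "\<exists>\<V>. countable \<V> \<and> \<V> \<subseteq> \<U> \<and> S0 \<subseteq> \<Union>\<V>"
        using T(1,2) M by (intro exI[of _ "M ` T"]) auto
    qed
  qed
  moreover have "\<not> strongly_D_space X"
  proof
    assume D: "strongly_D_space X"
    define nbhd where "nbhd = (\<lambda>p. \<iota> ` U (inv \<iota> p))"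
    have nbhd: "nbhd (\<iota> x) = \<iota> ` U x" for x by (simp add: nbhd_def inv_f_f[OF inj])
    have U_nb: "nb {x} {} {} {} = U x" for x by (simp add: nb_def)
    have "openin X (\<iota> ` U x)" for x
      using openin_Base[OF BaseI, of "{x}" "{}" "{}" "{}"] by (simp add: U_nb)
    moreover have "x \<in> U x" for x by (simp add: U_def)
    ultimately have "neighbourhood_assignment X nbhd"
      by (auto simp: neighbourhood_assignment_def topspace_X nbhd)
    with D obtain D0 where D0: "D0 \<subseteq> topspace X" "topspace X \<subseteq> (\<Union>x\<in>D0. nbhd x)"
      "locally_finite_for X nbhd D0"
      unfolding strongly_D_space_def by blast
    define D1 where "D1 = \<iota> -` D0"
    have D0_eq: "D0 = \<iota> ` D1" using D0(1) topspace_X by (auto simp: D1_def)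
    have lf: "\<exists>F. finite F \<and> z \<in> (\<Inter>x\<in>F. U x) \<and> finite (D1 \<inter> (\<Inter>x\<in>F. U x))" for z
    proof -
      have "\<exists>F\<subseteq>topspace X. finite F \<and> \<iota> z \<in> (\<Inter>x\<in>F. nbhd x) \<and> finite (D0 \<inter> (\<Inter>x\<in>F. nbhd x))"
        using D0(3) unfolding locally_finite_for_def by (rule bspec) (simp add: topspace_X)
      then obtain F where F: "F \<subseteq> topspace X" "finite F" "\<iota> z \<in> (\<Inter>x\<in>F. nbhd x)"
        "finite (D0 \<inter> (\<Inter>x\<in>F. nbhd x))" by (elim exE conjE)
      obtain F' where F': "F = \<iota> ` F'" using F(1) topspace_X by (auto simp: subset_image_iff)
      have "finite F'" using F(2) inj unfolding F' by (meson finite_imageD inj_on_subset subset_UNIV)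
      moreover have "z \<in> (\<Inter>x\<in>F'. U x)"
        using F(3) unfolding F' by (auto simp: nbhd inj_image_mem_iff[OF inj])
      moreover have "\<iota> ` (D1 \<inter> (\<Inter>x\<in>F'. U x)) \<subseteq> D0 \<inter> (\<Inter>x\<in>F. nbhd x)"
        unfolding F' D0_eq by (auto simp: nbhd)
      then have "finite (D1 \<inter> (\<Inter>x\<in>F'. U x))"
        using F(4) inj by (meson finite_imageD finite_subset inj_on_subset subset_UNIV)
      ultimately show ?thesis by blast
    qed
    then obtain F where F: "\<And>z. finite (F z)" "\<And>z. z \<in> (\<Inter>x\<in>F z. U x)"
      "\<And>z. finite (D1 \<inter> (\<Inter>x\<in>F z. U x))" by metis
    \<comment> \<open>Countably many of the open sets witnessing local finiteness cover the space,
      and each meets \<open>D1\<close> in a finite set. This gives the countability of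
      \<open>D1\<close> that \<open>locally_finite_not_cover\<close> requires.\<close>
    have "\<exists>T\<subseteq>UNIV. countable T \<and>
      UNIV \<subseteq> (\<Union>x\<in>T. {y \<in> UNIV. (\<forall>h\<in>F x. y \<in> U h) \<and> (\<forall>h\<in>{}. y \<notin> U h)})"
      by (rule countable_subcover) (use F in auto)
    moreover have "{y \<in> UNIV. (\<forall>h\<in>F x. y \<in> U h) \<and> (\<forall>h\<in>{}. y \<notin> U h)} = (\<Inter>h\<in>F x. U h)" for x
      by auto
    ultimately obtain T where T: "countable T" "UNIV \<subseteq> (\<Union>z\<in>T. \<Inter>x\<in>F z. U x)" by auto
    then have "D1 \<subseteq> (\<Union>z\<in>T. D1 \<inter> (\<Inter>x\<in>F z. U x))" by blast
    moreover have "countable (\<Union>z\<in>T. D1 \<inter> (\<Inter>x\<in>F z. U x))"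
      using T(1) F(3) by (intro countable_UN) (simp_all add: countable_finite)
    ultimately have "countable D1" by (rule countable_subset)
    then obtain y where y: "\<And>x. x \<in> D1 \<Longrightarrow> y \<notin> U x"
      using locally_finite_not_cover[OF _ lf] by metis
    have "\<iota> y \<in> (\<Union>x\<in>D0. nbhd x)" using D0(2) topspace_X by blast
    then show False using y unfolding D0_eq by (auto simp: nbhd inj_image_mem_iff[OF inj])
  qed
  ultimately show ?thesis by blast
qed

end

section \<open>Countable ordinals\<close>

lemma countable_imp_bounded:
  fixes M :: "'a::wellorder set"
  assumes below: "\<And>a::'a. countable {..<a}" and unc: "uncountable (UNIV :: 'a set)" and "countable M"
  obtains b where "\<And>m. m \<in> M \<Longrightarrow> m < b"
proof -
  have "countable {..m}" for m :: 'a by (rule countable_atMost_if_lessThan[OF below])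
  then have "countable (\<Union>m\<in>M. {..m})" using \<open>countable M\<close> by blast
  then have "(\<Union>m\<in>M. {..m}) \<noteq> UNIV" using unc by metis
  then obtain b where "b \<notin> (\<Union>m\<in>M. {..m})" by blast
  then have "m < b" if "m \<in> M" for m using that by (auto simp: not_le)
  then show ?thesis by (rule that)
qed

text \<open>Iterate a closing-off step from \<open>a\<close>; each finite set below the supremum
  \<open>c\<close> of the stages already lies below one of them.\<close>

lemma closed_ordinal_above:
  fixes g :: "'a::wellorder set \<Rightarrow> 'a set"
  assumes below: "\<And>a::'a. countable {..<a}" and unc: "uncountable (UNIV :: 'a set)"
    and g: "\<And>H. finite H \<Longrightarrow> countable (g H)"
  obtains c where "a < c" "\<And>H. \<lbrakk>finite H; H \<subseteq> {..<c}\<rbrakk> \<Longrightarrow> g H \<subseteq> {..<c}"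
proof -
  have "\<exists>b'. b < b' \<and> (\<forall>H. finite H \<longrightarrow> H \<subseteq> {..b} \<longrightarrow> g H \<subseteq> {..<b'})" for b
  proof -
    let ?M = "insert b (\<Union>H\<in>{H. finite H \<and> H \<subseteq> {..b}}. g H)"
    have "countable {..b}" by (rule countable_atMost_if_lessThan[OF below])
    then have "countable (\<Union>H\<in>{H. finite H \<and> H \<subseteq> {..b}}. g H)"
      by (intro countable_UN countable_Collect_finite_subset) (simp_all add: g)
    then have "countable ?M" by simp
    then obtain b' where "\<And>m. m \<in> ?M \<Longrightarrow> m < b'"
      using countable_imp_bounded[OF below unc] by metis
    then show ?thesis by (intro exI[of _ b']) auto
  qed
  then obtain nxt where nxt: "\<And>b. b < nxt b"
    "\<And>b H. \<lbrakk>finite H; H \<subseteq> {..b}\<rbrakk> \<Longrightarrow> g H \<subseteq> {..<nxt b}" by metis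
  define s where "s = (\<lambda>n. (nxt ^^ n) a)"
  have s_Suc: "s (Suc n) = nxt (s n)" for n by (simp add: s_def)
  have s_mono: "s m \<le> s n" if "m \<le> n" for m n
    by (rule lift_Suc_mono_le[of s, OF _ that]) (simp add: s_Suc nxt(1) less_imp_le)
  obtain b where b: "\<And>m. m \<in> range s \<Longrightarrow> m < b"
    using countable_imp_bounded[OF below unc, of "range s"] by auto
  define c where "c = (LEAST c. \<forall>n. s n < c)"
  have "\<forall>n. s n < c"
    unfolding c_def by (rule LeastI[of _ b]) (simp add: b)
  then have s_less: "s n < c" for n ..
  have c_least: "\<exists>n. h \<le> s n" if "h < c" for h
    using not_less_Least[of h "\<lambda>c. \<forall>n. s n < c"] that unfolding c_def by (auto simp: not_less)
  show ?thesis
  proof (rule that)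
    show "a < c" using s_less[of 0] by (simp add: s_def)
    fix H assume H: "finite H" "H \<subseteq> {..<c}"
    then have "\<exists>n. H \<subseteq> {..s n}"
    proof (induction H)
      case empty
      then show ?case by simp
    next
      case (insert x H)
      then obtain m where "H \<subseteq> {..s m}" by auto
      moreover obtain n where "x \<le> s n" using c_least[of x] insert(4) by auto
      ultimately have "insert x H \<subseteq> {..s (max m n)}"
        using s_mono[of m "max m n"] s_mono[of n "max m n"] by (auto intro: order_trans)
      then show ?case by blast
    qed
    then obtain n where "H \<subseteq> {..s n}" ..
    then have "g H \<subseteq> {..<s (Suc n)}" using nxt(2) H(1) by (simp add: s_Suc)
    then show "g H \<subseteq> {..<c}" using s_less[of "Suc n"] by auto
  qed
qed

text \<open>A finite set is determined by its maximum and its index among the countably many finite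
  subsets of the segment up to that maximum. The pairing \<open>t\<close> exists because an infinite
  set is equinumerous with its square.\<close>

lemma block_code_exists:
  assumes below: "\<And>a::'a::wellorder. countable {..<a}" and inf: "infinite (UNIV :: 'a set)"
  shows "\<exists>e :: 'a set \<times> 'a set \<Rightarrow> 'a. inj_on e {p. finite (supp p)}"
proof -
  have "(card_of ((UNIV :: 'a set) \<times> (UNIV :: 'a set)), card_of (UNIV :: 'a set)) \<in> ordIso"
    by (rule card_of_Times_same_infinite[OF inf])
  then obtain t :: "'a \<times> 'a \<Rightarrow> 'a" where "bij_betw t (UNIV \<times> UNIV) UNIV"
    using card_of_ordIso by blast
  then have t: "t p = t q \<longleftrightarrow> p = q" for p q by (simp add: bij_betw_def inj_eq)
  obtain k :: "nat \<Rightarrow> 'a" where k: "inj k"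
    using infinite_countable_subset[OF inf] by blast
  define Fin where "Fin = (\<lambda>b::'a. {F. finite F \<and> F \<subseteq> {..b}})"
  have Fin: "countable (Fin b)" for b
    unfolding Fin_def
    by (rule countable_Collect_finite_subset[OF countable_atMost_if_lessThan[OF below]])
  define code where "code = (\<lambda>F. t (Max F, k (to_nat_on (Fin (Max F)) F)))"
  have code: "F = G" if "finite F" "finite G" "code F = code G" for F G
  proof -
    have eq: "Max F = Max G" "to_nat_on (Fin (Max F)) F = to_nat_on (Fin (Max F)) G"
      using that(3) k by (auto simp: code_def t inj_eq)
    \<comment> \<open>\<open>Max {}\<close> is unspecified, but the empty set belongs to every
      \<open>Fin b\<close>.\<close>
    moreover have "F \<in> Fin (Max F)" "G \<in> Fin (Max G)" using that by (auto simp: Fin_def)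
    ultimately show ?thesis using Fin by (metis to_nat_on_inj)
  qed
  have "inj_on (\<lambda>p. t (code (fst p), code (snd p))) {p. finite (supp p)}"
  proof (rule inj_onI)
    fix p q :: "'a set \<times> 'a set"
    assume "p \<in> {p. finite (supp p)}" "q \<in> {p. finite (supp p)}"
      "t (code (fst p), code (snd p)) = t (code (fst q), code (snd q))"
    then have "fst p = fst q" "snd p = snd q"
      by (intro code; simp add: t supp_def)+
    then show "p = q" by (rule prod_eqI)
  qed
  then show ?thesis by blast
qed

section \<open>A wellordered type for \<open>omega1\<close> and the transfer of diamond to
  it\<close>

typedef countable_ordinal = "Field omega1"
  using uncountable_omega1 by (metis countable_empty ex_in_conv)

instantiation countable_ordinal :: wellorder
begin

definition less_eq_countable_ordinal :: "countable_ordinal \<Rightarrow> countable_ordinal \<Rightarrow> bool" where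
  "a \<le> b \<longleftrightarrow> (Rep_countable_ordinal a, Rep_countable_ordinal b) \<in> omega1"

definition less_countable_ordinal :: "countable_ordinal \<Rightarrow> countable_ordinal \<Rightarrow> bool" where
  "a < b \<longleftrightarrow> Rep_countable_ordinal a \<in> underS omega1 (Rep_countable_ordinal b)"

instance
proof
  have wo: "refl_on (Field omega1) omega1" "trans omega1" "antisym omega1"
    "total_on (Field omega1) omega1" "wf (omega1 - Id)"
    using Well_order_omega1
    by (simp_all add: well_order_on_def linear_order_on_def partial_order_on_def preorder_on_def)
  note R = Rep_countable_ordinal Rep_countable_ordinal_inject
  fix x y z :: countable_ordinal
  show "x \<le> x" using wo(1) R by (simp add: less_eq_countable_ordinal_def refl_on_def)
  show "x < y \<longleftrightarrow> x \<le> y \<and> \<not> y \<le> x"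
    using wo(1) R(1)[of x] R(2)[of x y] antisymD[OF wo(3)]
    unfolding less_eq_countable_ordinal_def less_countable_ordinal_def underS_def refl_on_def
    by auto
  show "x \<le> y \<Longrightarrow> y \<le> z \<Longrightarrow> x \<le> z"
    using wo(2) unfolding less_eq_countable_ordinal_def by (meson transD)
  show "x \<le> y \<Longrightarrow> y \<le> x \<Longrightarrow> x = y"
    using wo(3) R unfolding less_eq_countable_ordinal_def by (meson antisymD)
  show "x \<le> y \<or> y \<le> x"
    using wo(1,4) R unfolding less_eq_countable_ordinal_def total_on_def refl_on_def by metis
  fix P :: "countable_ordinal \<Rightarrow> bool" and a
  assume P: "\<And>x. (\<And>y. y < x \<Longrightarrow> P y) \<Longrightarrow> P x"
  have "wf (inv_image (omega1 - Id) Rep_countable_ordinal)" using wo(5) by (rule wf_inv_image)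
  then show "P a"
  proof (induction a rule: wf_induct_rule)
    case (less x)
    show ?case
      by (rule P, rule less) (simp add: less_countable_ordinal_def underS_def in_inv_image)
  qed
qed

end

lemma range_Rep: "range Rep_countable_ordinal = Field omega1"
  using type_definition.Rep_range[OF type_definition_countable_ordinal] .

lemma Rep_lessThan: "Rep_countable_ordinal ` {..<a} = underS omega1 (Rep_countable_ordinal a)"
proof (intro equalityI subsetI)
  fix x assume x: "x \<in> underS omega1 (Rep_countable_ordinal a)"
  then have "x \<in> range Rep_countable_ordinal"
    unfolding range_Rep by (auto simp: underS_def Field_def)
  then obtain y where "x = Rep_countable_ordinal y" by blast
  with x show "x \<in> Rep_countable_ordinal ` {..<a}" by (simp add: less_countable_ordinal_def)
qed (auto simp: less_countable_ordinal_def)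

lemma inj_Rep: "inj Rep_countable_ordinal"
  by (simp add: inj_on_def Rep_countable_ordinal_inject)

lemma countable_lessThan: "countable {..<a :: countable_ordinal}"
proof -
  have "countable (Rep_countable_ordinal ` {..<a})"
    unfolding Rep_lessThan by (rule countable_underS_omega1[OF Rep_countable_ordinal])
  then show ?thesis using countable_image_inj_on inj_Rep inj_on_subset by blast
qed

lemma uncountable_countable_ordinals: "uncountable (UNIV :: countable_ordinal set)"
  using uncountable_omega1 range_Rep by (metis countable_image)

text \<open>The points closed under \<open>g\<close> form a club: unbounded by
  \<open>closed_ordinal_above\<close>, and closed because a finite set below a limit of such points
  lies below one of them. Stationarity gives a correct guess inside this club.\<close>

lemma diamond_guess:
  assumes "diamond"
  shows "\<exists>A :: countable_ordinal \<Rightarrow> countable_ordinal set. \<forall>B g.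
    (\<forall>H. finite H \<longrightarrow> countable (g H)) \<longrightarrow>
    (\<exists>c. B \<inter> {..<c} = A c \<and> (\<forall>H. finite H \<longrightarrow> H \<subseteq> {..<c} \<longrightarrow> g H \<subseteq> {..<c}))"
proof -
  let ?R = Rep_countable_ordinal
  obtain A0 where A0: "\<And>\<alpha>. \<alpha> \<in> Field omega1 \<Longrightarrow> A0 \<alpha> \<subseteq> underS omega1 \<alpha>"
    "\<And>B. B \<subseteq> Field omega1 \<Longrightarrow> stationary_omega1 {\<alpha> \<in> Field omega1. B \<inter> underS omega1 \<alpha> = A0 \<alpha>}"
    using assms unfolding diamond_def by blast
  have "\<exists>c. B \<inter> {..<c} = ?R -` A0 (?R c) \<and> (\<forall>H. finite H \<longrightarrow> H \<subseteq> {..<c} \<longrightarrow> g H \<subseteq> {..<c})"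
    if g: "\<forall>H. finite H \<longrightarrow> countable (g H)" for B :: "countable_ordinal set" and g
  proof -
    define C where "C = {c. \<forall>H. finite H \<longrightarrow> H \<subseteq> {..<c} \<longrightarrow> g H \<subseteq> {..<c}}"
    have "unbounded_omega1 (?R ` C)"
      unfolding unbounded_omega1_def
    proof
      fix \<alpha> assume "\<alpha> \<in> Field omega1"
      then obtain a where a: "\<alpha> = ?R a" using range_Rep by blast
      obtain c where "a < c" "\<And>H. \<lbrakk>finite H; H \<subseteq> {..<c}\<rbrakk> \<Longrightarrow> g H \<subseteq> {..<c}"
        using closed_ordinal_above[OF countable_lessThan uncountable_countable_ordinals, of g a] g
        by metis
      then have "c \<in> C" "\<alpha> \<in> underS omega1 (?R c)"
        by (simp_all add: C_def a less_countable_ordinal_def)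
      then show "\<exists>\<beta>\<in>?R ` C. \<alpha> \<in> underS omega1 \<beta>" by blast
    qed
    moreover have "closed_omega1 (?R ` C)"
      unfolding closed_omega1_def
    proof (intro ballI impI)
      fix \<delta> assume "\<delta> \<in> Field omega1" and lim: "underS omega1 \<delta> \<noteq> {} \<and>
        (\<forall>\<alpha>\<in>underS omega1 \<delta>. \<exists>\<beta>\<in>?R ` C \<inter> underS omega1 \<delta>. \<alpha> \<in> underS omega1 \<beta>)"
      then obtain d where d: "\<delta> = ?R d" using range_Rep by blast
      have step: "\<exists>b\<in>C. a < b \<and> b < d" if "a < d" for a
        using lim that unfolding d less_countable_ordinal_def by blast
      have "{..<d} \<noteq> {}" using lim unfolding d Rep_lessThan[symmetric] by blast
      then obtain a0 where a0: "a0 < d" by blast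
      have "g H \<subseteq> {..<d}" if H: "finite H" "H \<subseteq> {..<d}" for H
      proof -
        \<comment> \<open>Inserting \<open>a0\<close> gives the maximum a meaning for
          \<open>H = {}\<close> too.\<close>
        have "Max (insert a0 H) < d" using H a0 by auto
        then obtain b where b: "b \<in> C" "Max (insert a0 H) < b" "b < d" using step by blast
        then have "H \<subseteq> {..<b}" using H(1) by auto
        then have "g H \<subseteq> {..<b}" using b(1) H(1) by (simp add: C_def)
        then show ?thesis using b(3) by auto
      qed
      then show "\<delta> \<in> ?R ` C" unfolding d by (simp add: C_def)
    qed
    ultimately have "club_omega1 (?R ` C)"
      unfolding club_omega1_def using range_Rep by blast
    moreover have "?R ` B \<subseteq> Field omega1" using range_Rep by blast
    ultimately obtain \<alpha> where \<alpha>: "\<alpha> \<in> ?R ` C" "?R ` B \<inter> underS omega1 \<alpha> = A0 \<alpha>"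
      using A0(2)[of "?R ` B"] unfolding stationary_omega1_def by blast
    then obtain c where c: "\<alpha> = ?R c" "c \<in> C" by blast
    have "A0 (?R c) = ?R ` (B \<inter> {..<c})"
      using \<alpha>(2) unfolding c(1) Rep_lessThan[symmetric] by (simp add: image_Int[OF inj_Rep])
    then have "B \<inter> {..<c} = ?R -` A0 (?R c)" by (simp add: inj_vimage_image_eq[OF inj_Rep])
    then show ?thesis using c(2) unfolding C_def by blast
  qed
  then show ?thesis by (intro exI[of _ "\<lambda>c. ?R -` A0 (?R c)"]) simp
qed

theorem theorem1:
  assumes "diamond"
  shows "\<exists>X :: nat set topology.
    zero_dimensional_space X \<and> Hausdorff_space X \<and> hereditarily_Lindelof_space X \<and>
    \<not> strongly_D_space X"
proof -
  obtain A :: "countable_ordinal \<Rightarrow> countable_ordinal set" where A: "\<And>B g.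
    (\<forall>H. finite H \<longrightarrow> countable (g H)) \<longrightarrow>
    (\<exists>c. B \<inter> {..<c} = A c \<and> (\<forall>H. finite H \<longrightarrow> H \<subseteq> {..<c} \<longrightarrow> g H \<subseteq> {..<c}))"
    using diamond_guess[OF assms] by blast
  obtain e :: "countable_ordinal set \<times> countable_ordinal set \<Rightarrow> countable_ordinal"
    where e: "inj_on e {p. finite (supp p)}"
    using block_code_exists[OF countable_lessThan] uncountable_infinite[OF uncountable_countable_ordinals]
    by blast
  interpret guessing_sequence A e
    by unfold_locales (use countable_lessThan uncountable_countable_ordinals A e in auto)
  obtain V where V: "\<forall>c. good_step V c (V c)" using good_sequence_exists by blast
  interpret good_sequence A e V
    by unfold_locales (use V in blast)
  show ?thesis by (rule space_exists[OF inj_Rep])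
qed

end
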